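(* Fix $d\in\mathbb{N}$ and let $f_d:\mathbb{R}\to\mathbb{R}$ be \[ f_d(a) = \begin{cases} 1 + |a| & a \leq 0,\\ \left(\sum_{i = 0}^{d - 1} a^i\right)^{-1} & 0 \leq a \leq 1,\\ 1 + 1/d - a & 1 \leq a \leq 1 + 1/d,\\ 0 & a \geq 1 + 1/d. \end{cases} \] Fix $(a,A)\in\mathbb{R}^2$. Then: (i) If $A < f_d(a)$, then for every $\epsilon > 0$, $\mathbb{R}^d$ is uniformly $\epsilon\Psi_{a,A}$-approximable. (ii) If $A > f_d(a)$, then $\mathbb{R}^d$ is not uniformly $\kappa\Psi_{a,A}$-approximable for any $\kappa > 0$. (iii) If $A = f_d(a)$, then there exist $0 < \epsilon \leq \kappa < \infty$ such that $\mathbb{R}^d$ is uniformly $\kappa\Psi_{a,A}$-approximable but not uniformly $\epsilon\Psi_{a,A}$-approximable.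
   Context: $\|\cdot\|$ denotes the max norm on $\mathbb{R}^d$. For $\Psi:\mathbb{N}\times\mathbb{N}\to(0,\infty)$ and $Q_0\in\mathbb{N}$, a point $\mathbf{x}\in\mathbb{R}^d$ is $(\Psi,Q_0)$-approximable if for every integer $Q\geq Q_0$ there exist $\mathbf{p}\in\mathbb{Z}^d$ and an integer $1\leq q\leq Q$ with $\|\mathbf{x}-\mathbf{p}/q\| < \Psi(q,Q)$. A set $S\subseteq\mathbb{R}^d$ is uniformly $\Psi$-approximable if there is a single $Q_0\in\mathbb{N}$ such that every point of $S$ is $(\Psi,Q_0)$-approximable. For $a,A\in\mathbb{R}$, $\Psi_{a,A}(q,Q) = q^{-a}Q^{-A}$, and for a constant $c>0$, $c\Psi_{a,A}$ denotes the function $(q,Q)\mapsto c\,q^{-a}Q^{-A}$. *)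

theory Defs
  imports "HOL-Analysis.Analysis"
begin

definition maxnorm :: "real^'n \<Rightarrow> real" where
  "maxnorm x = Max (range (\<lambda>i. \<bar>x $ i\<bar>))"

definition approximable :: "(nat \<Rightarrow> nat \<Rightarrow> real) \<Rightarrow> nat \<Rightarrow> real^'n \<Rightarrow> bool" where
  "approximable Psi Q0 x \<longleftrightarrow>
     (\<forall>Q::nat. Q \<ge> Q0 \<longrightarrow>
        (\<exists>p::int^'n. \<exists>q::nat. 1 \<le> q \<and> q \<le> Q \<and>
           maxnorm (x - (1 / real q) *\<^sub>R (\<chi> i. real_of_int (p $ i))) < Psi q Q))"

definition uniformly_approximable :: "(real^'n) set \<Rightarrow> (nat \<Rightarrow> nat \<Rightarrow> real) \<Rightarrow> bool" where
  "uniformly_approximable S Psi \<longleftrightarrow> (\<exists>Q0::nat. \<forall>x\<in>S. approximable Psi Q0 x)"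

definition Psi :: "real \<Rightarrow> real \<Rightarrow> nat \<Rightarrow> nat \<Rightarrow> real" where
  "Psi a A q Q = real q powr (-a) * real Q powr (-A)"

definition f_d :: "nat \<Rightarrow> real \<Rightarrow> real" where
  "f_d d a =
     (if a \<le> 0 then 1 + \<bar>a\<bar>
      else if a \<le> 1 then 1 / (\<Sum>i<d. a ^ i)
      else if a \<le> 1 + 1 / real d then 1 + 1 / real d - a
      else 0)"

end

theory Submission
  imports Defs
begin

text \<open>
  Everything reduces to the critical exponent \<open>f = f_d d a\<close>: changing \<open>A\<close> multiplies the radius by a
  power of \<open>Q\<close>.

  Covering at \<open>A = f\<close>. For \<open>a \<le> 0\<close> take \<open>q = Q\<close>, for \<open>a \<ge> 1 + 1/d\<close> take \<open>q = 1\<close>, and the range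
  \<open>1 \<le> a \<le> 1 + 1/d\<close> follows from \<open>a = 1\<close>. For \<open>0 < a \<le> 1\<close> one looks for an integer vector with
  denominator about \<open>T\<close> near the line through \<open>(1, x)\<close>. By transference (a quantitative Kronecker theorem)
  there is one unless some integer functional is small on the relevant box; then \<open>x\<close> is very close to a
  rational hyperplane, and one continues inside it with a smaller \<open>T\<close>. Heights of rational subspaces
  are at least 1, which is what makes the scales \<open>D powr (1 + a + ... + a ^ (i - 1))\<close> work.

  Sharpness. For \<open>a \<le> 1\<close> the worst points lie extremely close to a flag of coordinate subspaces. For
  \<open>a > 1\<close> badly approximable points suffice; they are obtained by nested cubes.
\<close>

subsection \<open>A quantitative Kronecker theorem\<close>

lemma Ints_abs_less_1_eq_0: assumes "(x::real)\<in>\<int>" "\<bar>x\<bar><1" shows "x=0"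
  using assms by (auto elim!: Ints_cases)

text \<open>Induction on the rank: split off a nearly shortest vector \<open>b\<close> of the
  lattice \<open>range m\<close>, project orthogonally to \<open>b\<close>, solve there, and correct
  along \<open>b\<close>. Integrality of \<open>\<phi>\<close> on the kernel of \<open>m\<close>
  makes it well defined modulo 1 on the lattice, so \<open>v\<close> is a short point of a
  prescribed coset of the dual lattice.\<close>

lemma quantitative_kronecker:
  fixes m :: "'g::ab_group_add \<Rightarrow> 'a::euclidean_space" and \<phi> :: "'g \<Rightarrow> real"
  assumes "Modules.additive m" "Modules.additive \<phi>"
    and "\<And>g. m g = 0 \<Longrightarrow> \<phi> g \<in> \<int>"
    and "\<mu> > 0" "\<And>g. m g \<noteq> 0 \<Longrightarrow> \<mu> \<le> norm (m g)"
    and "dim (range m) \<le> k"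
  shows "\<exists>v. norm v \<le> (2^k - 1) / \<mu> \<and> (\<forall>g. v \<bullet> m g - \<phi> g \<in> \<int>)"
  using assms
proof (induction k arbitrary: m \<phi> \<mu>)
  case 0
  then have "m g = 0" for g
    by (auto simp: subset_iff)
  with 0 show ?case by (intro exI[of _ 0]) auto
next
  case (Suc k)
  interpret m: Modules.additive m by fact
  interpret \<phi>: Modules.additive \<phi> by fact
  show ?case
  proof (cases "\<forall>g. m g = 0")
    case True
    then show ?thesis using Suc.prems(3,4) by (intro exI[of _ 0]) (auto intro!: divide_nonneg_pos simp: one_le_power[of "2::real" "Suc k", simplified])
  next
    case False
    define N where "N = (\<lambda>g. norm (m g)) ` {g. m g \<noteq> 0}"
    define \<nu> where "\<nu> = Inf N"
    have N: "N \<noteq> {}" "bdd_below N"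
      using False by (auto simp: N_def intro!: bdd_belowI[of _ 0])
    have \<nu>: "\<mu> \<le> \<nu>" unfolding \<nu>_def
      using N Suc.prems(5) by (intro cInf_greatest) (auto simp: N_def)
    have \<nu>_le: "\<nu> \<le> norm (m g)" if "m g \<noteq> 0" for g
      unfolding \<nu>_def using N that by (intro cInf_lower) (auto simp: N_def)
    \<comment> \<open>An almost minimal vector avoids proving that the infimum is attained. The
      factor 3/2 is small enough: subtracting (1/2)^2 (3/2)^2 = 9/16 from 1 leaves 7/16, which
      exceeds (1/2)^2.\<close>
    have "\<nu> < 3/2 * \<nu>" using \<nu> \<open>\<mu> > 0\<close> by simp
    then have "\<exists>y\<in>N. y < 3/2 * \<nu>"
      using cInf_lessD[OF N(1), of "3/2 * \<nu>"] by (simp add: \<nu>_def[symmetric])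
    then obtain g0 where g0: "m g0 \<noteq> 0" "norm (m g0) < 3/2 * \<nu>"
      by (auto simp: N_def)
    define b where "b = m g0"
    have b: "b \<noteq> 0" "norm b < 3/2 * \<nu>" "\<nu> \<le> norm b"
      using g0 \<nu>_le by (auto simp: b_def)
    have bb: "b \<bullet> b > 0" using b by simp
    define P where "P w = w - ((b \<bullet> w) / (b \<bullet> b)) *\<^sub>R b" for w
    have P_add: "P (x + y) = P x + P y" for x y
      by (simp add: P_def inner_add_right add_divide_distrib scaleR_add_left)
    have P_orth: "b \<bullet> P w = 0" for w using bb by (simp add: P_def inner_diff_right)
    have w_eq: "w = P w + ((b \<bullet> w) / (b \<bullet> b)) *\<^sub>R b" for w by (simp add: P_def)
    have ints: "\<exists>h. m h = of_int j *\<^sub>R b \<and> \<phi> h = of_int j * \<phi> g0" for j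
    proof (induction j rule: int_induct[where k = 0])
      case base then show ?case by (intro exI[of _ 0]) (auto simp: m.zero \<phi>.zero)
    next
      case (step1 i)
      then obtain h where "m h = of_int i *\<^sub>R b \<and> \<phi> h = of_int i * \<phi> g0" by blast
      then show ?case
        by (intro exI[of _ "h + g0"]) (auto simp: m.add \<phi>.add b_def algebra_simps)
    next
      case (step2 i)
      then obtain h where "m h = of_int i *\<^sub>R b \<and> \<phi> h = of_int i * \<phi> g0" by blast
      then show ?case
        by (intro exI[of _ "h - g0"]) (auto simp: m.diff \<phi>.diff b_def algebra_simps)
    qed
    \<comment> \<open>Size reduction: subtracting a multiple of \<open>g0\<close> lifts the
      projection of \<open>m g\<close> to a lattice vector whose \<open>b\<close>-component is at
      most half of \<open>b\<close>.\<close>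
    have reduce: "\<exists>h j \<theta>. \<bar>\<theta>\<bar> \<le> 1/2 \<and> m h = P (m g) + \<theta> *\<^sub>R b \<and> \<phi> h = \<phi> g - of_int j * \<phi> g0
        \<and> (b \<bullet> m g) / (b \<bullet> b) = \<theta> + of_int j" for g
    proof -
      define c where "c = (b \<bullet> m g) / (b \<bullet> b)"
      obtain h where h: "m h = of_int (round c) *\<^sub>R b" "\<phi> h = of_int (round c) * \<phi> g0"
        using ints by blast
      have "\<bar>c - of_int (round c)\<bar> \<le> 1/2"
        using of_int_round_abs_le[of c] by (simp add: abs_minus_commute)
      moreover have "m (g - h) = P (m g) + (c - of_int (round c)) *\<^sub>R b"
        by (simp add: m.diff h P_def c_def algebra_simps)
      ultimately show ?thesis
        by (intro exI[of _ "g - h"] exI[of _ "round c"] exI[of _ "c - of_int (round c)"])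
          (auto simp: \<phi>.diff h c_def)
    qed
    \<comment> \<open>\<open>s\<close> represents \<open>\<phi> g0\<close> modulo 1 and becomes the
      value of \<open>v \<bullet> b\<close>; \<open>\<phi>'\<close> is what remains for the
      projected lattice once this component is fixed.\<close>
    define s where "s = \<phi> g0 - of_int (round (\<phi> g0))"
    have s: "\<bar>s\<bar> \<le> 1/2" unfolding s_def
      using of_int_round_abs_le[of "\<phi> g0"] by (simp add: abs_minus_commute)
    define m' where "m' g = P (m g)" for g
    define \<phi>' where "\<phi>' g = \<phi> g - s * ((b \<bullet> m g) / (b \<bullet> b))" for g
    have "\<exists>v. norm v \<le> (2^k - 1) / (\<nu>/2) \<and> (\<forall>g. v \<bullet> m' g - \<phi>' g \<in> \<int>)"
    proof (rule Suc.IH)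
      show "Modules.additive m'" by unfold_locales (simp add: m'_def m.add P_add)
      show "Modules.additive \<phi>'"
        by unfold_locales (simp add: \<phi>'_def m.add \<phi>.add inner_add_right add_divide_distrib algebra_simps)
      \<comment> \<open>If the projection vanishes, the reduced vector has norm below 3/4
        \<open>\<nu>\<close>, hence is 0, and the kernel condition applies to it.\<close>
      show "\<phi>' g \<in> \<int>" if g: "m' g = 0" for g
      proof -
        obtain h j \<theta> where h: "\<bar>\<theta>\<bar> \<le> 1/2" "m h = \<theta> *\<^sub>R b" "\<phi> h = \<phi> g - of_int j * \<phi> g0"
          "(b \<bullet> m g) / (b \<bullet> b) = \<theta> + of_int j"
          using reduce[of g] g by (auto simp: m'_def)
        have "norm (m h) \<le> 1/2 * norm b" using mult_right_mono[OF h(1), of "norm b"] by (simp add: h(2))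
        also have "\<dots> < \<nu>" using b \<nu> \<open>\<mu> > 0\<close> by simp
        finally have "m h = 0" using \<nu>_le[of h] by linarith
        then have "\<theta> = 0" "\<phi> h \<in> \<int>" using h(2) b Suc.prems(3) by auto
        have "\<phi>' g = \<phi> h + of_int j * of_int (round (\<phi> g0))"
          unfolding \<phi>'_def h(4) using h(3) \<open>\<theta> = 0\<close> by (simp add: s_def algebra_simps)
        then show ?thesis using \<open>\<phi> h \<in> \<int>\<close> by auto
      qed
      show "\<nu> / 2 > 0" using \<nu> \<open>\<mu> > 0\<close> by simp
      show "\<nu>/2 \<le> norm (m' g)" if g: "m' g \<noteq> 0" for g
      proof -
        obtain h j \<theta> where h: "\<bar>\<theta>\<bar> \<le> 1/2" "m h = m' g + \<theta> *\<^sub>R b"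
          using reduce[of g] by (auto simp: m'_def)
        have orth: "b \<bullet> m' g = 0" by (simp add: m'_def P_orth)
        then have "m' g \<bullet> m h = m' g \<bullet> m' g" by (simp add: h(2) inner_add_right inner_commute)
        with g have "m h \<noteq> 0" by auto
        then have "\<nu>^2 \<le> (norm (m h))^2" using \<nu>_le[of h] \<nu> \<open>\<mu> > 0\<close> by (intro power_mono) auto
        also have "\<dots> = (norm (m' g))^2 + \<theta>^2 * (norm b)^2"
          using orth norm_add_Pythagorean[of "m' g" "\<theta> *\<^sub>R b"]
          by (simp add: h(2) orthogonal_def inner_commute power_mult_distrib)
        also have "\<theta>^2 * (norm b)^2 \<le> (1/2)^2 * (3/2*\<nu>)^2"
          using h(1) b by (intro mult_mono power_mono abs_le_square_iff[THEN iffD1]) (auto simp: power2_eq_square)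
        finally have "\<nu>^2 * (7/16) \<le> (norm (m' g))^2" by (simp add: power2_eq_square)
        moreover have "(\<nu>/2)^2 = \<nu>^2 / 4" by (simp add: power_divide)
        ultimately have "(\<nu>/2)^2 \<le> (norm (m' g))^2"
          using zero_le_power2[of "norm (m' g)"] by linarith
        then show ?thesis by (rule power2_le_imp_le) simp
      qed
      show "dim (range m') \<le> k"
      proof -
        have sub: "range m' \<subseteq> span (range m)"
        proof safe
          fix g
          have "m g \<in> span (range m)" "b \<in> span (range m)" by (auto simp: span_base b_def)
          then show "m' g \<in> span (range m)"
            by (auto simp: m'_def P_def intro: span_diff span_scale)
        qed
        have "span (range m') \<subseteq> {y. b \<bullet> y = 0}"
          by (intro span_minimal subspace_hyperplane) (auto simp: m'_def P_orth)
        then have "b \<notin> span (range m')" using bb by auto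
        moreover have "b \<in> span (range m)" by (auto simp: span_base b_def)
        moreover have "span (range m') \<subseteq> span (range m)"
          using sub by (simp add: span_minimal)
        ultimately have "span (range m') \<subset> span (range m)" by blast
        then have "dim (range m') < dim (range m)" by (rule dim_psubset)
        with Suc.prems(6) show ?thesis by simp
      qed
    qed
    then obtain v' where v': "norm v' \<le> (2^k - 1) / (\<nu>/2)" "\<And>g. v' \<bullet> m' g - \<phi>' g \<in> \<int>"
      by blast
    define v where "v = P v' + (s / (b \<bullet> b)) *\<^sub>R b"
    have "(norm (P v'))^2 \<le> (norm v')^2"
      using P_orth[of v'] by (subst (3) w_eq) (simp add: power2_norm_eq_inner inner_add_left inner_add_right inner_commute)
    then have nP: "norm (P v') \<le> norm v'" by (rule power2_le_imp_le) simp
    have "norm v \<le> norm (P v') + \<bar>s\<bar> / norm b"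
      unfolding v_def
      by (rule order_trans[OF norm_triangle_ineq])
        (simp add: power2_norm_eq_inner[symmetric] power2_eq_square)
    also have "\<bar>s\<bar> / norm b \<le> (1/2) / \<mu>" using s b \<nu> \<open>\<mu> > 0\<close> by (intro frac_le) auto
    also have "norm (P v') \<le> (2^k - 1) / (\<mu>/2)"
    proof -
      have "(2^k - 1) / (\<nu>/2) \<le> (2^k - 1) / (\<mu>/2)"
        using \<nu> \<open>\<mu> > 0\<close> by (intro divide_left_mono) auto
      with nP v'(1) show ?thesis by linarith
    qed
    \<comment> \<open>Halving the minimum doubles the old bound, and the correction adds 1/2: 2 (2^k
      - 1) + 1/2 is below 2^(k+1) - 1.\<close>
    also have "(2^k - 1) / (\<mu>/2) + (1/2) / \<mu> \<le> (2^Suc k - 1) / \<mu>"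
      using \<open>\<mu> > 0\<close> by (simp add: field_simps)
    finally have nv: "norm v \<le> (2^Suc k - 1) / \<mu>" by simp
    have "v \<bullet> m g - \<phi> g \<in> \<int>" for g
    proof -
      have "P v' \<bullet> m g = v' \<bullet> m' g"
        by (simp add: m'_def P_def inner_diff_left inner_diff_right inner_commute)
      then have "v \<bullet> m g - \<phi> g = v' \<bullet> m' g - \<phi>' g"
        by (simp add: v_def \<phi>'_def inner_add_left)
      with v'(2) show ?thesis by simp
    qed
    with nv show ?thesis by blast
  qed
qed

subsection \<open>Integer flags\<close>

text \<open>
  The rows of \<open>A\<close> indexed by \<open>I\<close> are integer vectors with annihilator \<open>V\<close>, a rational subspace,
  and \<open>h\<close> is an upper bound for the covolume of the integer points of \<open>V\<close>, expressed through the
  determinant so that no volumes occur. The coordinate \<open>k0\<close> plays the role of the denominator: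
  \<open>Z \<in> V\<close> with \<open>Z $ k0 = 1\<close> represents a point of affine space. The rows outside \<open>I\<close> only serve
  as a witness that the determinant form is not identically zero, which forces \<open>h \<ge> 1\<close>.
\<close>
definition int_flag :: "'N::finite \<Rightarrow> 'N set \<Rightarrow> real^'N^'N \<Rightarrow> real^'N \<Rightarrow> real \<Rightarrow> bool" where
  "int_flag k0 I A Z h \<longleftrightarrow>
     (\<forall>i j. A $ i $ j \<in> \<int>) \<and> det A \<noteq> 0 \<and> (\<forall>i. i \<notin> I \<longrightarrow> norm (A $ i) = 1) \<and>
     Z $ k0 = 1 \<and> (\<forall>i\<in>I. A $ i \<bullet> Z = 0) \<and>
     (\<forall>z. \<bar>det (\<chi> i. if i \<in> I then A $ i else z i)\<bar> \<le> h * (\<Prod>i\<in>-I. norm (z i)))"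

lemma det_Ints:
  fixes A :: "real^'N^'N"
  assumes "\<And>i j. A $ i $ j \<in> \<int>"
  shows "det A \<in> \<int>"
  unfolding det_def using assms by (intro Ints_sum Ints_mult Ints_prod) auto

text \<open>A nonzero integer determinant has absolute value at least 1, and the rows in
  \<open>J\<close> contribute only the factor 1.\<close>

lemma height_ge_1:
  fixes A :: "real^'N^'N"
  assumes "\<And>i j. A $ i $ j \<in> \<int>" "det A \<noteq> 0" "\<And>i. i \<in> J \<Longrightarrow> norm (A $ i) = 1"
    and "\<bar>det A\<bar> \<le> h * (\<Prod>i\<in>J. norm (A $ i))"
  shows "1 \<le> h"
proof -
  have "\<not> \<bar>det A\<bar> < 1" using Ints_abs_less_1_eq_0[OF det_Ints[OF assms(1)]] assms(2) by blast
  moreover have "(\<Prod>i\<in>J. norm (A $ i)) = 1" using assms(3) by (simp add: prod.neutral)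
  ultimately show ?thesis using assms(4) by simp
qed

lemma int_flag_height_ge_1:
  assumes "int_flag k0 I A Z h"
  shows "1 \<le> h"
proof (rule height_ge_1[of A "-I"])
  have "\<bar>det (\<chi> i. if i \<in> I then A $ i else A $ i)\<bar> \<le> h * (\<Prod>i\<in>-I. norm (A $ i))"
    using assms unfolding int_flag_def by blast
  then show "\<bar>det A\<bar> \<le> h * (\<Prod>i\<in>-I. norm (A $ i))" by simp
qed (use assms in \<open>auto simp: int_flag_def\<close>)

text \<open>If every row annihilated the nonzero vector \<open>Z\<close>, the matrix would be
  singular. This is what ends the descent.\<close>

lemma int_flag_proper:
  assumes "int_flag k0 I A Z h"
  shows "I \<noteq> UNIV"
proof
  assume "I = UNIV"
  then have "A *v Z = 0"
    using assms by (auto simp: int_flag_def vec_eq_iff matrix_vector_mult_def inner_vec_def)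
  moreover have "det A \<noteq> 0" "Z $ k0 = 1" using assms by (auto simp: int_flag_def)
  ultimately show False
    by (metis invertible_det_nz matrix_left_invertible_ker invertible_left_inverse zero_index zero_neq_one)
qed

text \<open>Cramer's rule for rows. It tells which row can be exchanged for \<open>W\<close> while
  the determinant stays nonzero: any \<open>k\<close> with \<open>x $ k \<noteq> 0\<close>.\<close>

lemma row_expansion:
  fixes A :: "real^'N^'N"
  assumes "det A \<noteq> 0"
  obtains x where "W = (\<Sum>i\<in>UNIV. x $ i *\<^sub>R A $ i)"
    "\<And>k. det (\<chi> i. if i = k then W else A $ i) = x $ k * det A"
proof -
  obtain A' where A': "A' ** A = mat 1"
    using assms by (metis invertible_def invertible_det_nz)
  define x where "x = W v* A'"
  have "W = W v* (A' ** A)" by (simp add: A')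
  also have "\<dots> = x v* A" by (simp add: x_def vector_matrix_mul_assoc)
  also have "\<dots> = (\<Sum>i\<in>UNIV. x $ i *\<^sub>R A $ i)"
    by (simp add: vec_eq_iff vector_matrix_mult_def mult.commute)
  finally have W: "W = (\<Sum>i\<in>UNIV. x $ i *\<^sub>R A $ i)" .
  have row: "row i A = A $ i" for i by (simp add: row_def)
  have "det (\<chi> i. if i = k then W else A $ i) = x $ k * det A" for k
    using cramer_lemma_transpose[of k x A] unfolding row scalar_mult_eq_scaleR W[symmetric] .
  with W that show ?thesis by blast
qed

text \<open>Row operations with the rows in \<open>I\<close>. Hence a new integer row enters the
  height only through its component orthogonal to the old rows.\<close>

lemma det_replace_row_mod_span:
  fixes z :: "'N \<Rightarrow> real^'N"
  assumes "y \<in> span ((\<lambda>i. A $ i) ` I)" "j \<notin> I"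
  shows "det (\<chi> i. if i \<in> I then A $ i else (z(j := z' + y)) i) =
    det (\<chi> i. if i \<in> I then A $ i else (z(j := z')) i)" (is "_ = det ?M")
proof -
  have r: "row k ?M = (if k \<in> I then A $ k else (z(j := z')) k)" for k by (simp add: row_def)
  have "(\<lambda>i. A $ i) ` I \<subseteq> {row k ?M |k. k \<noteq> j}"
  proof safe
    fix i assume "i \<in> I"
    then show "\<exists>k. A $ i = row k ?M \<and> k \<noteq> j" using assms(2) r by (intro exI[of _ i]) auto
  qed
  then have "y \<in> vec.span {row k ?M |k. k \<noteq> j}"
    using assms(1) span_mono unfolding span_vec_eq by blast
  from det_row_span[OF this] have "det (\<chi> k. if k = j then row j ?M + y else row k ?M) = det ?M" .
  moreover have "(\<chi> k. if k = j then row j ?M + y else row k ?M) =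
    (\<chi> i. if i \<in> I then A $ i else (z(j := z' + y)) i)"
    using assms(2) unfolding r by (auto simp: vec_eq_iff)
  ultimately show ?thesis by simp
qed

lemma orthogonal_projection:
  fixes Y :: "'a::euclidean_space set"
  assumes "subspace Y"
  obtains p where "linear p" "\<And>w. p w \<in> Y" "\<And>y w. y \<in> Y \<Longrightarrow> y \<bullet> p w = y \<bullet> w"
proof -
  obtain E where E: "E \<subseteq> Y" "pairwise orthogonal E" "span E = Y"
    using orthonormal_basis_subspace[OF assms] by metis
  define p where "p w = (\<Sum>b\<in>E. (b \<bullet> w / (b \<bullet> b)) *\<^sub>R b)" for w
  have "linear p"
    by (rule linearI)
      (simp_all add: p_def inner_add_right add_divide_distrib scaleR_add_left sum.distrib scaleR_sum_right)
  moreover have "p w \<in> Y" for w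
    using E(1) assms by (auto simp: p_def intro!: subspace_sum subspace_scale)
  moreover have "y \<bullet> p w = y \<bullet> w" if "y \<in> Y" for y w
    using Gram_Schmidt_step[OF E(2), of y w] that E(3)
    by (simp add: orthogonal_def p_def inner_diff_right)
  ultimately show thesis using that by blast
qed

text \<open>
  The box \<open>|v $ k0| \<le> T, |v - v $ k0 Z| \<le> \<rho>\<close> in \<open>V\<close> is tested on integer functionals \<open>w\<close>: its polar
  norm of \<open>w\<close> is, up to constants, the norm of \<open>T \<langle>w, Z\<rangle> e + \<rho> p w\<close>, where \<open>p\<close> projects onto
  \<open>V \<inter> {y. y $ k0 = 0}\<close>. If no functional is small, the lattice of integer points of \<open>V\<close> meets a
  dilated translate of the box; a small one cuts \<open>V\<close> down to a hyperplane close to \<open>Z\<close>.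
\<close>
lemma int_flag_descent:
  fixes A :: "real^'N^'N"
  assumes flag: "int_flag k0 I A Z h" and T: "h \<le> T" and \<rho>: "\<rho> > 0" and B: "1 + norm Z \<le> B"
  defines "K \<equiv> 2 ^ CARD('N) * (2 * B)"
  shows "(\<exists>v. (\<forall>i. v $ i \<in> \<int>) \<and> K * T \<le> v $ k0 \<and> v $ k0 \<le> 3 * K * T \<and> norm (v - v $ k0 *\<^sub>R Z) \<le> K * \<rho>) \<or>
    (\<exists>j A' Z' h'. j \<notin> I \<and> int_flag k0 (insert j I) A' Z' h' \<and> h' * \<rho> \<le> h \<and> norm (Z' - Z) * h' * T \<le> h)"
proof -
  have h: "h \<ge> 1" by (rule int_flag_height_ge_1[OF flag])
  then have T1: "T \<ge> 1" using T by simp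
  have B1: "B \<ge> 1" using B norm_ge_zero[of Z] by linarith
  note F = flag[unfolded int_flag_def]
  have Zo: "Z $ k0 = 1" and ZI: "\<And>i. i \<in> I \<Longrightarrow> A $ i \<bullet> Z = 0" using F by auto
  define Y where "Y = {y. y $ k0 = 0 \<and> (\<forall>i\<in>I. A $ i \<bullet> y = 0)}"
  have "subspace Y" by (auto simp: Y_def subspace_def inner_add_right)
  then obtain p where p: "linear p" "\<And>w. p w \<in> Y" "\<And>y w. y \<in> Y \<Longrightarrow> y \<bullet> p w = y \<bullet> w"
    using orthogonal_projection by blast
  have po: "p w $ k0 = 0" for w using p(2)[of w] by (simp add: Y_def)
  define c where "c w = (\<chi> i. real_of_int (w $ i))" for w :: "int^'N"
  have c_add: "c (w + w') = c w + c w'" for w w' by (simp add: c_def vec_eq_iff)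
  define e where "e = (axis k0 1 :: real^'N)"
  have e: "y \<bullet> e = y $ k0" "e \<bullet> y = y $ k0" for y by (auto simp: e_def inner_axis inner_axis')
  define m where "m w = (T * (c w \<bullet> Z)) *\<^sub>R e + \<rho> *\<^sub>R p (c w)" for w
  have mo: "m w $ k0 = T * (c w \<bullet> Z)" for w by (simp add: m_def po e_def)
  have m_add: "m (w + w') = m w + m w'" for w w'
    by (simp add: m_def c_add linear_add[OF p(1)] inner_add_left algebra_simps)
  \<comment> \<open>\<open>2 * B * c0 = 1\<close> makes the two final estimates of the descent free
    of constants, and \<open>c0 \<le> 1/2\<close> allows \<open>\<alpha>\<close> to be absorbed
    below.\<close>
  define c0 where "c0 = 1 / (2 * B)"
  have c0: "c0 > 0" "c0 \<le> 1/2" "2 * B * c0 = 1" using B1 by (auto simp: c0_def)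
  show ?thesis
  proof (cases "\<forall>w. m w \<noteq> 0 \<longrightarrow> c0 \<le> norm (m w)")
    case True
    \<comment> \<open>This inhomogeneous term translates the box by \<open>2 * K\<close> in the
      direction of \<open>Z\<close>. As \<open>\<bar>u $ k0\<bar> \<le> K\<close>, the denominator
      lands between \<open>K * T\<close> and \<open>3 * K * T\<close>, in particular away from
      0.\<close>
    define \<phi> where "\<phi> w = - (2 * K) * (T * (c w \<bullet> Z))" for w
    have "\<exists>u. norm u \<le> (2 ^ CARD('N) - 1) / c0 \<and> (\<forall>w. u \<bullet> m w - \<phi> w \<in> \<int>)"
    proof (rule quantitative_kronecker)
      show "Modules.additive m" by unfold_locales (rule m_add)
      show "Modules.additive \<phi>" by unfold_locales (simp add: \<phi>_def c_add inner_add_left algebra_simps)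
      show "\<phi> w \<in> \<int>" if "m w = 0" for w
        using mo[of w] that by (auto simp: \<phi>_def)
      show "dim (range m) \<le> CARD('N)" using dim_subset_UNIV[of "range m"] by simp
    qed (use True c0 in auto)
    then obtain u where u: "norm u \<le> (2 ^ CARD('N) - 1) / c0" "\<And>w. u \<bullet> m w - \<phi> w \<in> \<int>"
      by blast
    have "(2 ^ CARD('N) - 1) / c0 \<le> K" using B1 by (simp add: K_def c0_def mult_right_mono)
    with u(1) have uK: "norm u \<le> K" by simp
    define s where "s = u $ k0 + 2 * K"
    have "\<bar>u $ k0\<bar> \<le> K" using component_le_norm_cart[of u k0] uK by linarith
    then have s: "K \<le> s" "s \<le> 3 * K" by (auto simp: s_def)
    define v where "v = (T * s) *\<^sub>R Z + \<rho> *\<^sub>R p u"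
    have vo: "v $ k0 = T * s" by (simp add: v_def Zo po)
    \<comment> \<open>Self-adjointness of \<open>p\<close> turns the pairing of \<open>v\<close>
      with \<open>c w\<close> into \<open>u \<bullet> m w - \<phi> w\<close>; testing on unit
      vectors then gives integer coordinates.\<close>
    have "v \<bullet> c w \<in> \<int>" for w
    proof -
      have "p u \<bullet> c w = u \<bullet> p (c w)"
        using p(3)[OF p(2)[of u], of "c w"] p(3)[OF p(2)[of "c w"], of u] by (simp add: inner_commute)
      then have "v \<bullet> c w = u \<bullet> m w - \<phi> w"
        by (simp add: v_def m_def \<phi>_def s_def inner_add_left inner_add_right e inner_commute algebra_simps)
      with u(2) show ?thesis by simp
    qed
    moreover have "c (axis i 1) = axis i 1" for i by (auto simp: c_def vec_eq_iff axis_def)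
    ultimately have "v \<bullet> axis i 1 \<in> \<int>" for i by metis
    then have "\<forall>i. v $ i \<in> \<int>" by (simp add: inner_axis)
    moreover have "K * T \<le> v $ k0" "v $ k0 \<le> 3 * K * T"
      using s T1 by (auto simp: vo mult.commute[of T] intro!: mult_right_mono)
    moreover have "norm (v - v $ k0 *\<^sub>R Z) \<le> K * \<rho>"
    proof -
      have "p u \<bullet> p u = p u \<bullet> u" using p(2,3) by blast
      then have "norm (p u) * norm (p u) \<le> norm (p u) * norm u"
        using norm_cauchy_schwarz[of "p u" u] by (simp add: power2_norm_eq_inner[symmetric] power2_eq_square)
      then have "norm (p u) \<le> norm u" by (cases "norm (p u) = 0") auto
      with uK \<rho> have "\<rho> * norm (p u) \<le> \<rho> * K" by (intro mult_left_mono) auto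
      then show ?thesis using \<rho> unfolding vo by (simp add: v_def mult.commute)
    qed
    ultimately show ?thesis by blast
  next
    case False
    then obtain w where w: "m w \<noteq> 0" "norm (m w) < c0" by force
    define W where "W = c w"
    define u where "u = p W"
    define \<alpha> where "\<alpha> = W \<bullet> Z"
    have uo: "u $ k0 = 0" and uI: "\<And>i. i \<in> I \<Longrightarrow> A $ i \<bullet> u = 0"
      using p(2)[of W] by (auto simp: u_def Y_def)
    have Wu: "W \<bullet> u = u \<bullet> u" using p(3)[OF p(2)[of W], of W] by (simp add: u_def inner_commute)
    have WY: "W \<bullet> y = u \<bullet> y" if "y \<in> Y" for y
      using p(3)[OF that, of W] by (simp add: u_def inner_commute)
    have \<alpha>T: "\<bar>\<alpha>\<bar> * T < c0"
      using component_le_norm_cart[of "m w" k0] w(2) T1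
      by (simp add: mo \<alpha>_def W_def abs_mult mult.commute)
    have "orthogonal ((T * \<alpha>) *\<^sub>R e) (\<rho> *\<^sub>R u)" by (simp add: orthogonal_def e uo)
    then have "(norm (m w))^2 = (norm ((T * \<alpha>) *\<^sub>R e))^2 + (norm (\<rho> *\<^sub>R u))^2"
      unfolding m_def W_def[symmetric] u_def[symmetric] \<alpha>_def[symmetric] by (rule norm_add_Pythagorean)
    then have "(\<rho> * norm u)^2 \<le> (norm (m w))^2" using \<rho> by simp
    then have "\<rho> * norm u \<le> norm (m w)" by (rule power2_le_imp_le) simp
    with w(2) have \<rho>u: "\<rho> * norm u < c0" by simp
    define R where "R = (\<lambda>i. A $ i) ` I"
    \<comment> \<open>\<open>z\<close> is the part of the small functional \<open>W\<close> not
      explained by the old rows; its norm is the factor by which the height changes.\<close>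
    obtain y z where yz: "y \<in> span R" "\<And>r. r \<in> span R \<Longrightarrow> orthogonal z r" "W = y + z"
      using orthogonal_subspace_decomp_exists[of R W] by metis
    have R_orth: "r \<bullet> x = 0" if "r \<in> span R" "\<And>i. i \<in> I \<Longrightarrow> A $ i \<bullet> x = 0" for r x
    proof -
      have "orthogonal x r"
        using that by (intro orthogonal_to_span[of r R]) (auto simp: orthogonal_def R_def inner_commute)
      then show ?thesis by (simp add: orthogonal_def inner_commute)
    qed
    have zI: "A $ i \<bullet> z = 0" if "i \<in> I" for i
      using yz(2)[of "A $ i"] that by (auto simp: orthogonal_def R_def span_base inner_commute)
    have z_nz: "z \<noteq> 0"
    proof
      assume "z = 0"
      then have "W \<in> span R" using yz by simp
      then have "\<alpha> = 0" "u \<bullet> u = 0"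
        using R_orth[of W Z] R_orth[of W u] ZI uI Wu by (auto simp: \<alpha>_def)
      then have "m w = 0" by (simp add: m_def W_def[symmetric] u_def[symmetric] \<alpha>_def)
      with w show False by simp
    qed
    \<comment> \<open>Evaluate \<open>W\<close> on \<open>z\<close>, which lies in the current
      subspace: the multiple of \<open>Z\<close> contributes through \<open>\<alpha>\<close>, the
      rest lies in \<open>Y\<close> and contributes through \<open>u\<close>.\<close>
    have "z \<bullet> z = W \<bullet> z"
      using yz(2)[OF yz(1)] by (simp add: yz(3) inner_add_left orthogonal_def inner_commute[of z y])
    also have "\<dots> = z $ k0 * \<alpha> + W \<bullet> (z - z $ k0 *\<^sub>R Z)"
      by (simp add: \<alpha>_def inner_diff_right)
    also have "W \<bullet> (z - z $ k0 *\<^sub>R Z) = u \<bullet> (z - z $ k0 *\<^sub>R Z)"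
      by (rule WY) (auto simp: Y_def Zo zI ZI inner_diff_right)
    also have "\<dots> \<le> norm u * norm (z - z $ k0 *\<^sub>R Z)" by (rule norm_cauchy_schwarz)
    also have "norm (z - z $ k0 *\<^sub>R Z) \<le> norm z + \<bar>z $ k0\<bar> * norm Z"
      using norm_triangle_ineq4[of z "z $ k0 *\<^sub>R Z"] by simp
    also have "\<dots> \<le> norm z * B"
    proof -
      have "\<bar>z $ k0\<bar> * norm Z \<le> norm z * norm Z"
        by (intro mult_right_mono component_le_norm_cart) auto
      also have "norm z + norm z * norm Z = norm z * (1 + norm Z)" by (simp add: algebra_simps)
      then have "norm z + norm z * norm Z \<le> norm z * B" using B by (simp add: mult_left_mono)
      finally show ?thesis using \<open>norm z + norm z * norm Z \<le> norm z * B\<close> by linarith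
    qed
    also have "z $ k0 * \<alpha> \<le> norm z * \<bar>\<alpha>\<bar>"
      by (metis abs_ge_self abs_ge_zero abs_mult component_le_norm_cart mult_right_mono order_trans)
    finally have "z \<bullet> z \<le> norm z * \<bar>\<alpha>\<bar> + norm u * (norm z * B)" by (simp add: mult_left_mono)
    then have "norm z * norm z \<le> norm z * (\<bar>\<alpha>\<bar> + B * norm u)"
      by (simp add: power2_norm_eq_inner[symmetric] power2_eq_square algebra_simps)
    then have z1: "norm z \<le> \<bar>\<alpha>\<bar> + B * norm u" using z_nz by simp
    obtain x where x: "W = (\<Sum>i\<in>UNIV. x $ i *\<^sub>R A $ i)"
      "\<And>k. det (\<chi> i. if i = k then W else A $ i) = x $ k * det A"
      using row_expansion[of A W] F by blast
    have "\<exists>j. j \<notin> I \<and> x $ j \<noteq> 0"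
    proof (rule ccontr)
      assume "\<not> ?thesis"
      then have "W = (\<Sum>i\<in>I. x $ i *\<^sub>R A $ i)"
        unfolding x(1) by (intro sum.mono_neutral_right) auto
      moreover have "(\<Sum>i\<in>I. x $ i *\<^sub>R A $ i) \<in> span R"
        by (intro span_sum span_scale span_base) (simp add: R_def)
      ultimately have "W \<in> span R" by simp
      then have "W - y \<in> span R" using yz(1) by (rule span_diff)
      then have "orthogonal z z" using yz(2,3) by simp
      with z_nz show False by (simp add: orthogonal_def)
    qed
    then obtain j where j: "j \<notin> I" "x $ j \<noteq> 0" by blast
    define A' where "A' = (\<chi> i. if i = j then W else A $ i)"
    have A'_Ints: "A' $ i $ k \<in> \<int>" for i k using F by (auto simp: A'_def W_def c_def)
    have A'_det: "det A' \<noteq> 0" using x(2)[of j] j F by (simp add: A'_def)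
    have A'_norm: "norm (A' $ i) = 1" if "i \<notin> insert j I" for i using F that by (simp add: A'_def)
    have bound: "\<bar>det (\<chi> i. if i \<in> insert j I then A' $ i else f i)\<bar> \<le>
        (h * norm z) * (\<Prod>i\<in>-insert j I. norm (f i))" for f
    proof -
      have "(\<chi> i. if i \<in> insert j I then A' $ i else f i) =
          (\<chi> i. if i \<in> I then A $ i else (f(j := z + y)) i)"
        using j by (auto simp: A'_def yz(3) vec_eq_iff add.commute)
      then have "det (\<chi> i. if i \<in> insert j I then A' $ i else f i) =
          det (\<chi> i. if i \<in> I then A $ i else (f(j := z)) i)"
        using det_replace_row_mod_span[of y A I j f z] yz(1) j by (simp add: R_def)
      also have "\<bar>\<dots>\<bar> \<le> h * (\<Prod>i\<in>-I. norm ((f(j := z)) i))" using F by blast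
      also have "-I = insert j (- insert j I)" using j by auto
      also have "(\<Prod>i\<in>insert j (- insert j I). norm ((f(j := z)) i)) =
          norm z * (\<Prod>i\<in>- insert j I. norm ((f(j := z)) i))" by (subst prod.insert) auto
      also have "(\<Prod>i\<in>- insert j I. norm ((f(j := z)) i)) = (\<Prod>i\<in>- insert j I. norm (f i))"
        by (intro prod.cong) auto
      finally show ?thesis by (simp add: mult.assoc)
    qed
    \<comment> \<open>Integrality bounds \<open>norm z\<close> below by \<open>1 / h\<close>,
      whereas \<open>h \<le> T\<close> makes \<open>\<bar>\<alpha>\<bar>\<close> at most half of
      that. So \<open>\<alpha>\<close> is absorbed in \<open>z1\<close>, and \<open>u\<close> is
      nonzero.\<close>
    have "1 \<le> h * norm z"
      using A'_Ints A'_det A'_norm bound[of "\<lambda>i. A' $ i"]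
      by (intro height_ge_1[of A' "- insert j I"]) auto
    moreover have "\<bar>\<alpha>\<bar> * h \<le> c0"
      using \<alpha>T mult_left_mono[OF T, of "\<bar>\<alpha>\<bar>"] by simp
    ultimately have "h * (2 * \<bar>\<alpha>\<bar>) \<le> h * norm z" using c0 by (simp add: mult.commute)
    then have "2 * \<bar>\<alpha>\<bar> \<le> norm z" using h by simp
    with z1 have zu: "norm z \<le> 2 * B * norm u" by simp
    then have u_nz: "u \<noteq> 0" using z_nz by auto
    define h' where "h' = h * (2 * B * norm u)"
    \<comment> \<open>The shift along \<open>u\<close> achieves \<open>W \<bullet> Z' = 0\<close>
      and preserves the old equations and the coordinate \<open>k0\<close>. Its length is
      \<open>\<bar>\<alpha>\<bar> / norm u\<close>, so \<open>norm u\<close> cancels against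
      \<open>h'\<close>.\<close>
    define Z' where "Z' = Z - (\<alpha> / (u \<bullet> u)) *\<^sub>R u"
    have "int_flag k0 (insert j I) A' Z' h'"
      unfolding int_flag_def
    proof (intro conjI allI ballI impI)
      show "Z' $ k0 = 1" by (simp add: Z'_def Zo uo)
      show "A' $ i \<bullet> Z' = 0" if "i \<in> insert j I" for i
        using that j u_nz
        by (auto simp: A'_def Z'_def inner_diff_right Wu \<alpha>_def[symmetric] uI ZI)
      fix f :: "'N \<Rightarrow> real^'N"
      have "h * norm z * (\<Prod>i\<in>-insert j I. norm (f i)) \<le> h' * (\<Prod>i\<in>-insert j I. norm (f i))"
        unfolding h'_def using h zu by (intro mult_right_mono mult_left_mono prod_nonneg) auto
      with bound[of f] show "\<bar>det (\<chi> i. if i \<in> insert j I then A' $ i else f i)\<bar>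
          \<le> h' * (\<Prod>i\<in>-insert j I. norm (f i))" by linarith
    qed (use A'_Ints A'_det A'_norm in auto)
    moreover have "h' * \<rho> \<le> h"
    proof -
      have "h' * \<rho> = h * (2 * B * (\<rho> * norm u))" by (simp add: h'_def)
      also have "\<dots> \<le> h * (2 * B * c0)" using \<rho>u h B1 by (intro mult_left_mono) auto
      finally show ?thesis using c0 by simp
    qed
    moreover have "norm (Z' - Z) * h' * T \<le> h"
    proof -
      have "norm (Z' - Z) = \<bar>\<alpha>\<bar> / norm u"
        using u_nz by (simp add: Z'_def power2_norm_eq_inner[symmetric] power2_eq_square)
      then have "norm (Z' - Z) * h' * T = h * (2 * B * (\<bar>\<alpha>\<bar> * T))"
        using u_nz by (simp add: h'_def)
      also have "\<dots> \<le> h * (2 * B * c0)" using \<alpha>T h B1 by (intro mult_left_mono) auto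
      finally show ?thesis using c0 by simp
    qed
    ultimately show ?thesis using j by blast
  qed
qed

text \<open>
  The scales \<open>\<sigma> i\<close> satisfy \<open>\<sigma> (i + 1) = D (\<sigma> i)\<^sup>a\<close> and are log-concave in \<open>i\<close>; in a subspace of dimension
  \<open>m + 1\<close> denominators of size \<open>h \<sigma> m\<close> are used. The descent stops in dimension 1 at the latest.
\<close>
lemma int_flag_good_vector:
  fixes X :: "real^'N" and a D B :: real and k0 :: 'N
  defines "\<sigma> \<equiv> \<lambda>i. D powr (\<Sum>j<i. a ^ j)"
  defines "K \<equiv> 2 ^ CARD('N) * (2 * B)"
  assumes a: "0 < a" "a \<le> 1" and D: "D \<ge> 1" and B: "1 + norm X + real CARD('N) \<le> B"
    and "int_flag k0 I A Z h" "card (-I) = Suc m"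
    and "norm (Z - X) * (h * \<sigma> (Suc m)) \<le> real (card I)"
  shows "\<exists>v. (\<forall>i. v $ i \<in> \<int>) \<and> 0 < v $ k0 \<and> v $ k0 \<le> 3 * K * (h * \<sigma> m) \<and>
    norm (v - v $ k0 *\<^sub>R X) \<le> (1 + 3 * real CARD('N)) * K * ((v $ k0) powr (1 - a) / D)"
  using assms(7-9)
proof (induction m arbitrary: I A Z h)
  have \<sigma>1: "\<sigma> i \<ge> 1" for i
    using a D by (auto simp: \<sigma>_def intro!: ge_one_powr_ge_zero sum_nonneg)
  have \<sigma>_Suc: "\<sigma> (Suc i) = D * \<sigma> i powr a" for i
  proof -
    have "\<sigma> (Suc i) = D powr (1 + a * (\<Sum>j<i. a ^ j))"
      unfolding \<sigma>_def sum.lessThan_Suc_shift by (simp add: sum_distrib_left)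
    then show ?thesis using D by (simp add: \<sigma>_def powr_add powr_powr mult.commute)
  qed
  have \<sigma>_concave: "\<sigma> (Suc (Suc i)) * \<sigma> i \<le> \<sigma> (Suc i) * \<sigma> (Suc i)" for i
  proof -
    have "a ^ Suc i \<le> a ^ i" using a by (intro power_decreasing) auto
    then show ?thesis unfolding \<sigma>_def powr_add[symmetric] using D by (intro powr_mono) auto
  qed
  have K: "K \<ge> 1"
  proof -
    have "1 \<le> 2 * B" using B norm_ge_zero[of X] by linarith
    moreover have "(1::real) \<le> 2 ^ CARD('N)" by simp
    ultimately show ?thesis unfolding K_def by (metis mult_mono mult_1 zero_le_one order_trans)
  qed
  \<comment> \<open>\<open>P\<close> collects the induction hypotheses and \<open>G\<close> the
    desired vector, so that one descent step serves both the base case and the inductive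
    case.\<close>
  define P where "P m I A Z h \<longleftrightarrow> int_flag k0 I A Z h \<and> card (-I) = Suc m \<and>
      norm (Z - X) * (h * \<sigma> (Suc m)) \<le> real (card I)" for m I A Z h
  define G where "G h m v \<longleftrightarrow> (\<forall>i. v $ i \<in> \<int>) \<and> 0 < v $ k0 \<and> v $ k0 \<le> 3 * K * (h * \<sigma> m) \<and>
    norm (v - v $ k0 *\<^sub>R X) \<le> (1 + 3 * real CARD('N)) * K * ((v $ k0) powr (1 - a) / D)" for h m v
  have step: "(\<exists>v. G h m v) \<or> (\<exists>m' I' A' Z' h'. m = Suc m' \<and> P m' I' A' Z' h' \<and> h' * \<sigma> m' \<le> h * \<sigma> m)"
    if P: "P m I A Z h" for m I A Z h
  proof -
    have flag: "int_flag k0 I A Z h" and cI: "card (-I) = Suc m"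
      and Z: "norm (Z - X) * (h * \<sigma> (Suc m)) \<le> real (card I)" using P by (auto simp: P_def)
    have h: "h \<ge> 1" by (rule int_flag_height_ge_1[OF flag])
    define T where "T = h * \<sigma> m"
    define \<rho> where "\<rho> = T powr (1 - a) / D"
    have T: "h \<le> T" "\<sigma> m \<le> T" "T > 0"
      using h \<sigma>1[of m] mult_mono[of h h 1 "\<sigma> m"] mult_mono[of 1 h "\<sigma> m" "\<sigma> m"] by (auto simp: T_def)
    have \<rho>: "\<rho> > 0" using T D by (simp add: \<rho>_def)
    \<comment> \<open>Split \<open>\<sigma> m\<close> into its powers \<open>1 - a\<close> and
      \<open>a\<close>: the first is at most \<open>T powr (1 - a)\<close>, the second is
      \<open>\<sigma> (Suc m) / D\<close>.\<close>
    have \<sigma>\<rho>: "\<sigma> m \<le> \<rho> * \<sigma> (Suc m)"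
    proof -
      have "\<sigma> m powr (1 - a) \<le> T powr (1 - a)"
        using T a \<sigma>1[of m] by (intro powr_mono2) auto
      then have "\<sigma> m powr (1 - a) * \<sigma> m powr a \<le> T powr (1 - a) * \<sigma> m powr a"
        by (intro mult_right_mono) auto
      also have "\<sigma> m powr (1 - a) * \<sigma> m powr a = \<sigma> m" using \<sigma>1[of m] by (simp add: powr_add[symmetric])
      finally show ?thesis using D by (simp add: \<rho>_def \<sigma>_Suc)
    qed
    have cI_le: "card I \<le> CARD('N)" by (rule card_mono) auto
    \<comment> \<open>The base point never drifts further than this, so the same \<open>B\<close>,
      and hence the same \<open>K\<close>, works at every stage.\<close>
    have ZX: "norm (Z - X) \<le> real CARD('N)"
    proof -
      have "1 \<le> h * \<sigma> (Suc m)" using h \<sigma>1[of "Suc m"] mult_mono[of 1 h 1 "\<sigma> (Suc m)"] by simp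
      then have "norm (Z - X) * 1 \<le> norm (Z - X) * (h * \<sigma> (Suc m))" by (intro mult_left_mono) auto
      with Z cI_le show ?thesis by simp
    qed
    have "1 + norm Z \<le> B" using ZX B norm_triangle_sub[of Z X] by simp
    from int_flag_descent[OF flag T(1) \<rho> this, folded K_def]
    consider (good) v where "\<forall>i. v $ i \<in> \<int>" "K * T \<le> v $ k0" "v $ k0 \<le> 3 * K * T" "norm (v - v $ k0 *\<^sub>R Z) \<le> K * \<rho>"
      | (down) j A' Z' h' where "j \<notin> I" "int_flag k0 (insert j I) A' Z' h'" "h' * \<rho> \<le> h" "norm (Z' - Z) * h' * T \<le> h"
      by blast
    then show ?thesis
    proof cases
      case good
      have Tv: "T \<le> v $ k0" using good(2) mult_right_mono[OF K, of T] T by linarith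
      have "norm (Z - X) * T \<le> real CARD('N) * \<rho>"
      proof -
        have "norm (Z - X) * T \<le> norm (Z - X) * (h * (\<rho> * \<sigma> (Suc m)))"
          unfolding T_def using \<sigma>\<rho> h by (intro mult_left_mono) auto
        also have "\<dots> = norm (Z - X) * (h * \<sigma> (Suc m)) * \<rho>" by simp
        also have "\<dots> \<le> real CARD('N) * \<rho>" using Z cI_le \<rho> by (intro mult_right_mono) auto
        finally show ?thesis .
      qed
      then have "3 * K * (norm (Z - X) * T) \<le> 3 * K * (real CARD('N) * \<rho>)"
        using K by (intro mult_left_mono) auto
      moreover have "v $ k0 * norm (Z - X) \<le> 3 * K * T * norm (Z - X)"
        using good(3) by (intro mult_right_mono) auto
      moreover have "norm (v - v $ k0 *\<^sub>R X) \<le> norm (v - v $ k0 *\<^sub>R Z) + v $ k0 * norm (Z - X)"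
      proof -
        have "v - v $ k0 *\<^sub>R X = (v - v $ k0 *\<^sub>R Z) + v $ k0 *\<^sub>R (Z - X)"
          by (simp add: algebra_simps)
        also have "norm \<dots> \<le> norm (v - v $ k0 *\<^sub>R Z) + norm (v $ k0 *\<^sub>R (Z - X))"
          by (rule norm_triangle_ineq)
        finally show ?thesis using Tv T by simp
      qed
      ultimately have "norm (v - v $ k0 *\<^sub>R X) \<le> (1 + 3 * real CARD('N)) * K * \<rho>"
        using good(4) by (simp add: algebra_simps)
      also have "\<dots> \<le> (1 + 3 * real CARD('N)) * K * ((v $ k0) powr (1 - a) / D)"
        unfolding \<rho>_def using Tv T a D K by (intro mult_left_mono divide_right_mono powr_mono2) auto
      finally show ?thesis using good Tv T by (auto simp: G_def T_def)
    next
      case down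
      have "- insert j I = (-I) - {j}" by auto
      then have c': "card (- insert j I) = m" using cI down(1) by (simp add: card_Diff_singleton)
      have h': "h' \<ge> 1" by (rule int_flag_height_ge_1[OF down(2)])
      \<comment> \<open>In dimension 1 no further row fits, so there the good alternative must
        occur.\<close>
      have "insert j I \<noteq> UNIV" by (rule int_flag_proper[OF down(2)])
      with c' have "m \<noteq> 0" by auto
      then obtain m' where m': "m = Suc m'" by (cases m) auto
      have hh: "h' * \<sigma> m \<le> h * \<sigma> (Suc m)"
      proof -
        have "h' * \<sigma> m \<le> h' * (\<rho> * \<sigma> (Suc m))" using \<sigma>\<rho> h' by (intro mult_left_mono) auto
        also have "\<dots> = h' * \<rho> * \<sigma> (Suc m)" by simp
        also have "\<dots> \<le> h * \<sigma> (Suc m)" using down(3) \<sigma>1[of "Suc m"] by (intro mult_right_mono) auto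
        finally show ?thesis .
      qed
      \<comment> \<open>Errors add up: by \<open>hh\<close> the old error keeps its weighted bound,
        and the new shift adds at most 1. Thus \<open>card I\<close> counts the descents made so
        far.\<close>
      have "norm (Z' - X) * (h' * \<sigma> (Suc m')) \<le> real (card (insert j I))"
      proof -
        have "norm (Z' - X) \<le> norm (Z' - Z) + norm (Z - X)" by (rule norm_diff_triangle_le) auto
        then have "norm (Z' - X) * (h' * \<sigma> m) \<le> (norm (Z' - Z) + norm (Z - X)) * (h' * \<sigma> m)"
          using h' \<sigma>1[of m] by (intro mult_right_mono) auto
        also have "\<dots> = norm (Z' - Z) * (h' * \<sigma> m) + norm (Z - X) * (h' * \<sigma> m)" by (rule distrib_right)
        also have "norm (Z - X) * (h' * \<sigma> m) \<le> norm (Z - X) * (h * \<sigma> (Suc m))"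
          using hh by (intro mult_left_mono) auto
        also have "\<dots> \<le> real (card I)" by (rule Z)
        also have "h * (norm (Z' - Z) * (h' * \<sigma> m)) \<le> h * 1"
          using down(4) by (simp add: T_def mult_ac)
        then have "norm (Z' - Z) * (h' * \<sigma> m) \<le> 1" using h by simp
        finally show ?thesis using down(1) m' by simp
      qed
      then have "P m' (insert j I) A' Z' h'" using down c' m' by (simp add: P_def)
      \<comment> \<open>Log-concavity of the scales ensures that the bound on the denominator does
        not grow during the descent.\<close>
      moreover have "h' * \<sigma> m' \<le> h * \<sigma> m"
      proof -
        have "\<sigma> m * (h' * \<sigma> m') = (h' * \<sigma> m) * \<sigma> m'" by simp
        also have "\<dots> \<le> h * \<sigma> (Suc m) * \<sigma> m'" using hh \<sigma>1[of m'] by (intro mult_right_mono) auto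
        also have "\<dots> = h * (\<sigma> (Suc (Suc m')) * \<sigma> m')" by (simp add: m')
        also have "\<dots> \<le> h * (\<sigma> (Suc m') * \<sigma> (Suc m'))" using \<sigma>_concave h by (intro mult_left_mono) auto
        also have "\<dots> = \<sigma> m * (h * \<sigma> m)" by (simp add: m')
        finally show ?thesis using \<sigma>1[of m] by simp
      qed
      ultimately show ?thesis using m' by blast
    qed
  qed
  {
    case 0
    then have "P 0 I A Z h" by (simp add: P_def)
    from step[OF this] show ?case unfolding G_def by auto
  next
    case (Suc m)
    then have "P (Suc m) I A Z h" by (simp add: P_def)
    from step[OF this] consider "\<exists>v. G h (Suc m) v"
      | I' A' Z' h' where "P m I' A' Z' h'" "h' * \<sigma> m \<le> h * \<sigma> (Suc m)" by auto
    then show ?case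
    proof cases
      case 1
      then show ?thesis unfolding G_def .
    next
      case 2
      then obtain v where "G h' m v" using Suc.IH[of I' A' Z' h'] unfolding P_def G_def by blast
      moreover have "3 * K * (h' * \<sigma> m) \<le> 3 * K * (h * \<sigma> (Suc m))"
        using 2(2) K by (intro mult_left_mono) auto
      ultimately have "G h (Suc m) v" unfolding G_def by auto
      then show ?thesis unfolding G_def by blast
    qed
  }
qed

section \<open>Covering for exponents between 0 and 1\<close>

lemma det_le_fact_prod_norm:
  fixes z :: "'N \<Rightarrow> real^'N"
  shows "\<bar>det (\<chi> i. z i)\<bar> \<le> fact CARD('N) * (\<Prod>i\<in>UNIV. norm (z i))"
proof -
  have "\<bar>det (\<chi> i. z i)\<bar> \<le> (\<Sum>p | p permutes (UNIV :: 'N set). \<bar>of_int (sign p) * (\<Prod>i\<in>UNIV. z i $ p i)\<bar>)"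
    unfolding det_def by (rule order_trans[OF sum_abs]) simp
  also have "\<dots> \<le> (\<Sum>p | p permutes (UNIV :: 'N set). \<Prod>i\<in>UNIV. norm (z i))"
  proof (rule sum_mono)
    fix p :: "'N \<Rightarrow> 'N"
    have "\<bar>of_int (sign p) * (\<Prod>i\<in>UNIV. z i $ p i)\<bar> = (\<Prod>i\<in>UNIV. \<bar>z i $ p i\<bar>)"
      by (simp add: abs_mult abs_prod sign_def)
    also have "\<dots> \<le> (\<Prod>i\<in>UNIV. norm (z i))" by (intro prod_mono) (auto simp: component_le_norm_cart)
    finally show "\<bar>of_int (sign p) * (\<Prod>i\<in>UNIV. z i $ p i)\<bar> \<le> (\<Prod>i\<in>UNIV. norm (z i))" .
  qed
  also have "\<dots> = fact CARD('N) * (\<Prod>i\<in>UNIV. norm (z i))"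
    by (simp add: card_permutations[OF refl finite])
  finally show ?thesis .
qed

text \<open>The descent starts from the whole homogenised space, where \<open>None\<close> indexes
  the denominator and the Leibniz formula gives height at most \<open>fact N\<close>. Dividing the
  resulting error by the denominator \<open>q\<close> yields a multiple of
  \<open>Psi a A q Q\<close>.\<close>

lemma critical_upper_bound_0_1:
  fixes a :: real
  assumes a: "0 < a" "a \<le> 1"
  defines "A \<equiv> 1 / (\<Sum>i<CARD('n::finite). a ^ i)"
  shows "\<exists>C>0. \<exists>Q0. \<forall>Q\<ge>Q0. \<forall>x::real^'n. \<exists>p::int^'n. \<exists>q. 1 \<le> q \<and> q \<le> Q \<and>
    (\<forall>i. \<bar>x $ i - p $ i / real q\<bar> \<le> C * Psi a A q Q)"
proof -
  define N where "N = CARD('n option)"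
  have N: "N = Suc CARD('n)" by (simp add: N_def)
  define B where "B = 1 + 2 * real N"
  define K where "K = 2 ^ N * (2 * B)"
  define L where "L = 3 * K * fact N"
  define C1 where "C1 = (1 + 3 * real N) * K"
  have K: "K > 0" by (simp add: K_def B_def add_pos_nonneg)
  then have L: "L > 0" by (simp add: L_def)
  have C1: "C1 > 0" using K by (simp add: C1_def add_pos_nonneg)
  have S: "(\<Sum>i<CARD('n). a ^ i) > 0" using a by (intro sum_pos) (auto simp: lessThan_empty_iff)
  then have A: "A > 0" by (simp add: A_def)
  have main: "\<exists>p::int^'n. \<exists>q. 1 \<le> q \<and> q \<le> Q \<and>
      (\<forall>i. \<bar>x $ i - p $ i / real q\<bar> \<le> C1 * L powr A * Psi a A q Q)"
    if Q: "Q \<ge> nat \<lceil>L\<rceil>" for Q and x :: "real^'n"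
  proof -
    have LQ: "L \<le> real Q" using Q by linarith
    \<comment> \<open>With this \<open>D\<close> the top scale is \<open>real Q / L\<close>, and
      \<open>L\<close> is exactly the constant that brings the denominator bound down to
      \<open>Q\<close>.\<close>
    define D where "D = (real Q / L) powr A"
    have D: "D \<ge> 1" using LQ L A by (auto simp: D_def intro: ge_one_powr_ge_zero)
    \<comment> \<open>Fractional parts keep \<open>norm X\<close> bounded, so the constants do not
      depend on \<open>x\<close>; the integer parts return in \<open>p\<close>.\<close>
    define X :: "real^'n option" where "X = (\<chi> k. case k of None \<Rightarrow> 1 | Some i \<Rightarrow> frac (x $ i))"
    have "norm X \<le> (\<Sum>k\<in>UNIV. \<bar>X $ k\<bar>)" by (rule norm_le_l1_cart)
    also have "\<dots> \<le> (\<Sum>k\<in>(UNIV :: 'n option set). 1)"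
      by (intro sum_mono) (auto simp: X_def split: option.split intro: less_imp_le frac_lt_1)
    finally have X: "norm X \<le> real N" by (simp add: N_def)
    have \<sigma>: "D powr (\<Sum>j<CARD('n). a ^ j) = real Q / L"
      using S LQ L by (simp add: D_def powr_powr A_def)
    have "mat 1 $ k = axis k (1::real)" for k :: "'n option"
      by (simp add: mat_def axis_def vec_eq_iff)
    moreover have "mat 1 $ k $ l \<in> (\<int> :: real set)" for k l :: "'n option"
      by (simp add: mat_def)
    ultimately have "int_flag None {} (mat 1) X (fact N)"
      using det_le_fact_prod_norm[where 'N = "'n option"]
      by (simp add: int_flag_def X_def N_def del: fact_Suc)
    moreover have "card (- ({} :: 'n option set)) = Suc CARD('n)" by (simp add: Compl_eq_Diff_UNIV)
    moreover have "1 + norm X + real CARD('n option) \<le> B" using X by (simp add: B_def N_def)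
    ultimately obtain v where v: "\<And>k. v $ k \<in> \<int>" "0 < v $ None" "v $ None \<le> 3 * K * (fact N * (real Q / L))"
      "norm (v - v $ None *\<^sub>R X) \<le> C1 * ((v $ None) powr (1 - a) / D)"
      using int_flag_good_vector[of a D X B None "{}" "mat 1" X "fact N" "CARD('n)"] a D
      unfolding \<sigma> N_def[symmetric] K_def[symmetric] C1_def[symmetric] by auto
    define q where "q = nat \<lfloor>v $ None\<rfloor>"
    have fl: "of_int \<lfloor>v $ k\<rfloor> = v $ k" for k using v(1)[of k] by (simp add: of_int_floor)
    have q: "real q = v $ None" using v(2) fl[of None] by (simp add: q_def)
    have "q \<ge> 1" using q v(2) by linarith
    have "v $ None \<le> real Q" using v(3) L K by (simp add: L_def)
    then have "q \<le> Q" using q by simp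
    define p :: "int^'n" where "p = (\<chi> i. \<lfloor>v $ Some i\<rfloor> + int q * \<lfloor>x $ i\<rfloor>)"
    have "\<bar>x $ i - p $ i / real q\<bar> \<le> C1 * L powr A * Psi a A q Q" for i
    proof -
      have "x $ i - p $ i / real q = frac (x $ i) - v $ Some i / real q"
        using \<open>q \<ge> 1\<close> by (simp add: p_def fl frac_def field_simps)
      also have "\<dots> = - ((v - v $ None *\<^sub>R X) $ Some i) / real q"
        using \<open>q \<ge> 1\<close> by (simp add: X_def q[symmetric] field_simps)
      finally have "\<bar>x $ i - p $ i / real q\<bar> = \<bar>(v - v $ None *\<^sub>R X) $ Some i\<bar> / real q"
        by (simp only: abs_divide abs_minus_cancel abs_of_nat)
      also have "\<dots> \<le> C1 * (real q powr (1 - a) / D) / real q"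
        using order_trans[OF component_le_norm_cart v(4)] unfolding q by (intro divide_right_mono) (use v(2) in auto)
      also have "\<dots> = C1 * L powr A * Psi a A q Q"
        using \<open>q \<ge> 1\<close> \<open>q \<le> Q\<close> L
        by (simp add: D_def Psi_def powr_diff powr_divide powr_minus field_simps)
      finally show ?thesis .
    qed
    with \<open>q \<ge> 1\<close> \<open>q \<le> Q\<close> show ?thesis by blast
  qed
  show ?thesis
    using C1 L main by (intro exI[of _ "C1 * L powr A"] conjI exI[of _ "nat \<lceil>L\<rceil>"]) auto
qed

subsection \<open>Badly approximable points\<close>

text \<open>Pigeonhole: there are (M+1)^d coefficient vectors with entries from 0 to M, but only M^d
  intervals for the fractional parts. The difference of two colliding vectors is
  \<open>b\<close>.\<close>

lemma dual_dirichlet: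
  fixes x :: "real^'n"
  assumes M: "M \<ge> 1"
  obtains b :: "int^'n" and b0 :: int where "b \<noteq> 0" "\<And>i. \<bar>b $ i\<bar> \<le> int M"
    "\<bar>(\<Sum>i\<in>UNIV. b $ i * x $ i) - b0\<bar> < 1 / real M ^ CARD('n)"
proof -
  define S where "S = (UNIV :: 'n set) \<rightarrow>\<^sub>E {..M}"
  define T where "T = real M ^ CARD('n)"
  have T: "T > 0" using M by (simp add: T_def)
  define l where "l f = (\<Sum>i\<in>UNIV. real (f i) * x $ i)" for f :: "'n \<Rightarrow> nat"
  define g where "g f = nat \<lfloor>frac (l f) * T\<rfloor>" for f
  have "card S = Suc M ^ CARD('n)" by (simp add: S_def card_PiE)
  have "g f < M ^ CARD('n)" for f
  proof -
    have "frac (l f) * T < T" using T frac_lt_1[of "l f"] by simp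
    then have "\<lfloor>frac (l f) * T\<rfloor> < int (M ^ CARD('n))" by (simp add: T_def floor_less_iff)
    moreover have "0 \<le> \<lfloor>frac (l f) * T\<rfloor>" using T by simp
    ultimately show ?thesis by (simp add: g_def nat_less_iff)
  qed
  then have "card (g ` S) \<le> card {..<M ^ CARD('n)}" by (intro card_mono) auto
  also have "\<dots> < card S" using \<open>card S = _\<close> by (simp add: power_strict_mono del: power_Suc)
  finally have "\<not> inj_on g S" by (rule pigeonhole)
  then obtain f f' where f: "f \<in> S" "f' \<in> S" "f \<noteq> f'" "g f = g f'" by (auto simp: inj_on_def)
  define b :: "int^'n" where "b = (\<chi> i. int (f i) - int (f' i))"
  have "b \<noteq> 0" using f(3) by (auto simp: b_def vec_eq_iff fun_eq_iff)
  moreover have "\<bar>b $ i\<bar> \<le> int M" for i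
  proof -
    have "f i \<le> M" "f' i \<le> M" using f(1,2) by (auto simp: S_def PiE_def Pi_def)
    then show ?thesis by (simp add: b_def)
  qed
  moreover have "\<bar>(\<Sum>i\<in>UNIV. b $ i * x $ i) - (\<lfloor>l f\<rfloor> - \<lfloor>l f'\<rfloor>)\<bar> < 1 / T"
  proof -
    have "\<lfloor>frac (l f) * T\<rfloor> = \<lfloor>frac (l f') * T\<rfloor>"
      using f(4) T by (simp add: g_def nat_eq_iff)
    then have "\<bar>frac (l f) * T - frac (l f') * T\<bar> < 1" by linarith
    then have "\<bar>frac (l f) - frac (l f')\<bar> * T < 1"
      using T by (simp add: left_diff_distrib[symmetric] abs_mult)
    moreover have "(\<Sum>i\<in>UNIV. b $ i * x $ i) = l f - l f'"
      by (simp add: l_def b_def sum_subtractf[symmetric] left_diff_distrib)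
    then have "(\<Sum>i\<in>UNIV. b $ i * x $ i) - (\<lfloor>l f\<rfloor> - \<lfloor>l f'\<rfloor>) = frac (l f) - frac (l f')"
      by (simp add: frac_def)
    ultimately show ?thesis using T by (simp only: pos_less_divide_eq)
  qed
  ultimately show thesis using that[of b "\<lfloor>l f\<rfloor> - \<lfloor>l f'\<rfloor>"] by (simp add: T_def)
qed

text \<open>
  The form found by the dual Dirichlet theorem at the centre of a cube of radius \<open>r K\<close> is so small on
  the cube that it vanishes at every rational point there with denominator at most \<open>R ^ (K * d) / 2\<close>.
  So these points lie on one hyperplane, from which the next cube is moved away.
\<close>
lemma nested_cubes_avoid_rationals:
  fixes r :: "nat \<Rightarrow> real"
  defines "d \<equiv> CARD('n::finite)"
  defines "R \<equiv> 4 * d"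
  defines "r \<equiv> \<lambda>k. 1 / (real d * real R ^ (k * (d + 1)))"
  shows "\<exists>y::real^'n. \<forall>x. (\<forall>i. \<bar>x $ i - y $ i\<bar> \<le> r K) \<longrightarrow>
    (\<forall>k<K. \<forall>q p. 1 \<le> q \<longrightarrow> 2 * q \<le> R ^ (k * d) \<longrightarrow> (\<exists>i. r k / (4 * real d) \<le> \<bar>x $ i - of_int (p i) / real q\<bar>))"
proof (induction K)
  case 0
  show ?case by simp
next
  case (Suc K)
  have d: "d \<ge> 1" by (simp add: d_def Suc_le_eq)
  then have R: "R \<ge> 4" by (simp add: R_def)
  have r_pos: "r k > 0" for k using d R by (simp add: r_def)
  define \<delta> where "\<delta> = r K / (4 * real d)"
  have \<delta>: "\<delta> > 0" "\<delta> \<le> r K / 4" "real d * (2 * \<delta>) = r K / 2"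
    using r_pos[of K] d by (auto simp: \<delta>_def field_simps)
  have r_Suc: "r (Suc K) \<le> \<delta>"
  proof -
    have "real R ^ 1 \<le> real R ^ (d + 1)" using R by (intro power_increasing) auto
    then have "4 * real d \<le> real R ^ (d + 1)" by (simp add: R_def)
    then have "r K / real R ^ (d + 1) \<le> \<delta>"
      unfolding \<delta>_def using r_pos[of K] d by (intro divide_left_mono) auto
    then show ?thesis by (simp add: r_def power_add mult_ac)
  qed
  obtain y :: "real^'n" where y: "\<And>x k q p. (\<forall>i. \<bar>x $ i - y $ i\<bar> \<le> r K) \<Longrightarrow> k < K \<Longrightarrow> 1 \<le> q
      \<Longrightarrow> 2 * q \<le> R ^ (k * d) \<Longrightarrow> (\<exists>i. r k / (4 * real d) \<le> \<bar>x $ i - of_int (p i) / real q\<bar>)"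
    using Suc.IH by blast
  have "R ^ K \<ge> 1" using R by simp
  then obtain b :: "int^'n" and b0 :: int where b: "b \<noteq> 0" "\<And>i. \<bar>b $ i\<bar> \<le> int (R ^ K)"
    "\<bar>(\<Sum>i\<in>UNIV. b $ i * y $ i) - b0\<bar> < 1 / real (R ^ K) ^ d"
    using dual_dirichlet[of "R ^ K" y] unfolding d_def by metis
  \<comment> \<open>Over the cube the form varies by at most this amount, the same as the bound for
    its value at the centre \<open>y\<close>.\<close>
  have Mr: "real d * (real (R ^ K) * r K) = 1 / real (R ^ K) ^ d"
    using d R by (simp add: r_def power_add power_mult[symmetric])
  define \<beta> where "\<beta> = Max (range (\<lambda>i. \<bar>b $ i\<bar>))"
  have \<beta>: "\<bar>b $ i\<bar> \<le> \<beta>" for i unfolding \<beta>_def by (intro Max_ge) auto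
  have "\<beta> \<in> range (\<lambda>i. \<bar>b $ i\<bar>)" unfolding \<beta>_def by (intro Max_in) auto
  then obtain j where j: "\<beta> = \<bar>b $ j\<bar>" by auto
  have \<beta>_pos: "\<beta> > 0"
  proof -
    obtain i where "b $ i \<noteq> 0" using b(1) by (auto simp: vec_eq_iff)
    then show ?thesis using \<beta>[of i] by linarith
  qed
  define E where "E x = (\<Sum>i\<in>UNIV. b $ i * x $ i) - b0" for x :: "real^'n"
  have E_diff: "\<bar>E x - E x'\<bar> \<le> real_of_int \<beta> * (\<Sum>i\<in>UNIV. \<bar>x $ i - x' $ i\<bar>)" for x x'
  proof -
    have "E x - E x' = (\<Sum>i\<in>UNIV. b $ i * (x $ i - x' $ i))"
      by (simp add: E_def sum_subtractf[symmetric] right_diff_distrib)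
    also have "\<bar>\<dots>\<bar> \<le> (\<Sum>i\<in>UNIV. \<bar>b $ i * (x $ i - x' $ i)\<bar>)" by (rule sum_abs)
    also have "\<dots> \<le> (\<Sum>i\<in>UNIV. real_of_int \<beta> * \<bar>x $ i - x' $ i\<bar>)"
      unfolding abs_mult using \<beta> by (intro sum_mono mult_right_mono) (auto simp flip: of_int_abs)
    finally show ?thesis by (simp add: sum_distrib_left)
  qed
  \<comment> \<open>Move by half the radius in the coordinate with the largest coefficient, with the
    sign that increases the absolute value of the form.\<close>
  define s where "s = (if b $ j * E y \<ge> 0 then 1 else -1 :: real)"
  define y' where "y' = y + (s * (r K / 2)) *\<^sub>R axis j 1"
  have E_y': "E y' = E y + b $ j * (s * (r K / 2))"
  proof -
    have "(\<Sum>i\<in>UNIV. b $ i * y' $ i) =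
        (\<Sum>i\<in>UNIV. b $ i * y $ i + (if i = j then b $ i * (s * (r K / 2)) else 0))"
      by (intro sum.cong) (auto simp: y'_def axis_def distrib_left)
    then show ?thesis by (simp add: E_def sum.distrib)
  qed
  have far: "real_of_int \<beta> * (r K / 2) \<le> \<bar>E y'\<bar>"
  proof -
    define t where "t = b $ j * (s * (r K / 2))"
    have "0 \<le> E y * (b $ j * s)" by (auto simp: s_def mult.commute)
    then have "0 \<le> E y * (b $ j * s) * (r K / 2)"
      by (rule mult_nonneg_nonneg) (use r_pos[of K] in simp)
    also have "\<dots> = E y * t" by (simp add: t_def)
    finally have "t\<^sup>2 \<le> (E y + t)\<^sup>2" unfolding power2_sum using zero_le_power2[of "E y"] by linarith
    then have "\<bar>b $ j * (s * (r K / 2))\<bar> \<le> \<bar>E y'\<bar>"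
      unfolding E_y' t_def by (rule abs_le_square_iff[THEN iffD2])
    moreover have "\<bar>s\<bar> = 1" by (simp add: s_def)
    ultimately show ?thesis using r_pos[of K] by (simp add: j abs_mult)
  qed
  have "\<exists>i. r k / (4 * real d) \<le> \<bar>x $ i - of_int (p i) / real q\<bar>"
    if x: "\<And>i. \<bar>x $ i - y' $ i\<bar> \<le> r (Suc K)" and k: "k < Suc K" and q: "1 \<le> q" "2 * q \<le> R ^ (k * d)"
    for x :: "real^'n" and k q and p :: "'n \<Rightarrow> int"
  proof -
    have yy: "\<bar>y' $ i - y $ i\<bar> \<le> r K / 2" for i
      using r_pos[of K] by (auto simp: y'_def axis_def s_def)
    have xy: "\<bar>x $ i - y $ i\<bar> \<le> r K / 2 + \<delta>" for i
      using x[of i] yy[of i] r_Suc by linarith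
    show ?thesis
    proof (cases "k < K")
      case True
      have "\<bar>x $ i - y $ i\<bar> \<le> r K" for i
        using xy[of i] \<delta> r_pos[of K] by linarith
      then show ?thesis using y[of x k q p] True q by blast
    next
      case False
      with k have [simp]: "k = K" by simp
      show ?thesis
      proof (rule ccontr)
        assume "\<not> ?thesis"
        then have near: "\<bar>x $ i - of_int (p i) / real q\<bar> < \<delta>" for i by (auto simp: \<delta>_def not_le)
        define P :: "real^'n" where "P = (\<chi> i. of_int (p i) / real q)"
        have "\<bar>P $ i - y $ i\<bar> \<le> r K" for i
          using near[of i] xy[of i] \<delta> by (simp add: P_def)
        then have "(\<Sum>i\<in>UNIV. \<bar>P $ i - y $ i\<bar>) \<le> real d * r K"
          using sum_bounded_above[of UNIV "\<lambda>i. \<bar>P $ i - y $ i\<bar>" "r K"] by (simp add: d_def)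
        then have "real_of_int \<beta> * (\<Sum>i\<in>UNIV. \<bar>P $ i - y $ i\<bar>) \<le> real (R ^ K) * (real d * r K)"
          using b(2)[of j] j \<beta>_pos r_pos[of K] by (intro mult_mono sum_nonneg) linarith+
        then have "\<bar>E P\<bar> < 2 * (1 / real (R ^ K) ^ d)"
          using E_diff[of P y] b(3) Mr by (simp add: E_def[of y, symmetric] mult.left_commute)
        also have "\<dots> \<le> 1 / real q"
        proof -
          have "real (2 * q) \<le> real (R ^ (K * d))" using q(2) by (simp only: of_nat_le_iff \<open>k = K\<close>)
          then show ?thesis using q R by (simp add: power_mult[symmetric] field_simps)
        qed
        \<comment> \<open>Multiplied by \<open>q\<close>, the form takes an integer value at
          \<open>P\<close>, so being smaller than 1 forces it to vanish.\<close>
        finally have "\<bar>real q * E P\<bar> < 1" using q by (simp add: abs_mult field_simps)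
        moreover have "real q * E P = of_int ((\<Sum>i\<in>UNIV. b $ i * p i) - int q * b0)"
          using q by (simp add: E_def P_def right_diff_distrib sum_distrib_left)
        ultimately have "real q * E P = 0" using Ints_abs_less_1_eq_0[OF Ints_of_int] by metis
        then have "E P = 0" using q by simp
        \<comment> \<open>\<open>P\<close> would be so close to the new centre that the form at
          \<open>y'\<close> is below \<open>\<beta> * (r K / 2)\<close>, against
          \<open>far\<close>.\<close>
        have "\<bar>y' $ i - P $ i\<bar> < 2 * \<delta>" for i
          using near[of i] x[of i] r_Suc by (simp add: P_def)
        then have "(\<Sum>i\<in>UNIV. \<bar>y' $ i - P $ i\<bar>) < (\<Sum>i\<in>(UNIV::'n set). 2 * \<delta>)"
          by (intro sum_strict_mono) auto
        then have "(\<Sum>i\<in>UNIV. \<bar>y' $ i - P $ i\<bar>) < r K / 2" using \<delta>(3) by (simp add: d_def)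
        then have "real_of_int \<beta> * (\<Sum>i\<in>UNIV. \<bar>y' $ i - P $ i\<bar>) < real_of_int \<beta> * (r K / 2)"
          using \<beta>_pos by simp
        with E_diff[of y' P] far \<open>E P = 0\<close> show False by simp
      qed
    qed
  qed
  then show ?case by blast
qed

text \<open>Each denominator is handled at the cube level matching its size. Only \<open>c\<close>
  must be independent of \<open>Q\<close>, so finitely many nested cubes suffice and no limit point
  is taken.\<close>

lemma badly_approximable:
  "\<exists>c>0. \<forall>Q. \<exists>x::real^'n. \<forall>p::int^'n. \<forall>q. 1 \<le> q \<longrightarrow> q \<le> Q \<longrightarrow>
     (\<exists>i. c * real q powr (- (1 + 1 / real CARD('n::finite))) \<le> \<bar>x $ i - p $ i / real q\<bar>)"
proof -
  define d where "d = CARD('n)"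
  define R where "R = 4 * d"
  define r where "r k = 1 / (real d * real R ^ (k * (d + 1)))" for k
  define c where "c = 1 / (16 * real d ^ 2 * real R ^ (d + 1))"
  have d: "d \<ge> 1" by (simp add: d_def Suc_le_eq)
  then have R: "R \<ge> 4" by (simp add: R_def)
  have c: "c > 0" using d R by (simp add: c_def)
  have scale: "\<exists>k\<le>q. 2 * q \<le> R ^ (k * d) \<and> c * real q powr (- (1 + 1 / real d)) \<le> r k / (4 * real d)"
    if q: "q \<ge> 1" for q
  proof -
    \<comment> \<open>Minimality of \<open>k\<close> gives \<open>R ^ ((k - 1) * d) < 2 * q\<close>,
      so \<open>r k\<close> is of order at least q^-(1+1/d). The one-level gap costs the factor
      \<open>R ^ (d + 1)\<close> in \<open>c\<close>.\<close>
    define k where "k = (LEAST k. 2 * q \<le> R ^ (k * d))"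
    have "2 * q \<le> 4 ^ q"
    proof (induction q)
      case (Suc q)
      have "2 * Suc q \<le> 4 * z" if "2 * q \<le> z" "1 \<le> z" for z :: nat using that by simp
      from this[OF Suc.IH] show ?case by simp
    qed simp
    also have "\<dots> \<le> R ^ q" using R by (intro power_mono) auto
    also have "\<dots> \<le> R ^ (q * d)" using R d by (intro power_increasing) auto
    finally have ex: "2 * q \<le> R ^ (q * d)" .
    have k: "2 * q \<le> R ^ (k * d)" "k \<le> q"
      unfolding k_def using ex by (auto intro: LeastI Least_le)
    have "k \<noteq> 0" using k(1) q by (intro notI) simp
    then obtain l where l: "k = Suc l" by (cases k) auto
    then have "\<not> 2 * q \<le> R ^ (l * d)" using not_less_Least[of l "\<lambda>k. 2 * q \<le> R ^ (k * d)"] by (simp add: k_def)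
    then have "R ^ (l * d) \<le> 2 * q" by simp
    then have "real (R ^ (l * d)) \<le> real (2 * q)" by (simp only: of_nat_le_iff)
    then have "real R ^ (l * d) \<le> 2 * real q" by simp
    then have "(real R ^ (l * d)) powr (1 + 1 / real d) \<le> (2 * real q) powr (1 + 1 / real d)"
      using R by (intro powr_mono2) auto
    also have "\<dots> = 2 powr (1 + 1 / real d) * real q powr (1 + 1 / real d)"
      by (simp add: powr_mult)
    also have "(2::real) powr (1 + 1 / real d) \<le> 2 powr 2" using d by (intro powr_mono) (auto simp: field_simps)
    also have "(2::real) powr 2 = 4" by simp
    also have "(real R ^ (l * d)) powr (1 + 1 / real d) = real R ^ (l * (d + 1))"
    proof -
      have "(real R ^ (l * d)) powr (1 + 1 / real d) = real R powr (real (l * d) * (1 + 1 / real d))"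
        using R by (simp add: powr_realpow[symmetric] powr_powr)
      also have "real (l * d) * (1 + 1 / real d) = real (l * (d + 1))" using d by (simp add: field_simps)
      also have "real R powr real (l * (d + 1)) = real R ^ (l * (d + 1))"
        using R by (intro powr_realpow) simp
      finally show ?thesis .
    qed
    finally have "real R ^ (l * (d + 1)) \<le> 4 * real q powr (1 + 1 / real d)" by (simp add: mult_right_mono)
    then have "1 / (4 * real q powr (1 + 1 / real d)) \<le> 1 / real R ^ (l * (d + 1))"
      using R q by (intro divide_left_mono) auto
    then have "1 / (4 * real d ^ 2 * real R ^ (d + 1)) * (1 / (4 * real q powr (1 + 1 / real d)))
        \<le> 1 / (4 * real d ^ 2 * real R ^ (d + 1)) * (1 / real R ^ (l * (d + 1)))"
      using d R by (intro mult_left_mono) auto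
    also have "\<dots> = r k / (4 * real d)"
      by (simp add: r_def l power_add power2_eq_square)
    also have "1 / (4 * real d ^ 2 * real R ^ (d + 1)) * (1 / (4 * real q powr (1 + 1 / real d)))
        = c * real q powr (- (1 + 1 / real d))"
    proof -
      have "1 / (4 * x * y) * (1 / (4 * z)) = 1 / (16 * x * y) * (1 / z)" for x y z :: real by simp
      then show ?thesis unfolding c_def powr_minus_divide .
    qed
    finally show ?thesis using k by blast
  qed
  have "\<exists>x::real^'n. \<forall>p::int^'n. \<forall>q. 1 \<le> q \<longrightarrow> q \<le> Q \<longrightarrow>
     (\<exists>i. c * real q powr (- (1 + 1 / real d)) \<le> \<bar>x $ i - p $ i / real q\<bar>)" for Q
  proof -
    \<comment> \<open>Denominators up to \<open>Q\<close> use levels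
      \<open>k \<le> q \<le> Q\<close>, whence \<open>Suc Q\<close> levels; the centre of the last
      cube serves as the point.\<close>
    obtain x :: "real^'n" where x: "\<And>k q p. k < Suc Q \<Longrightarrow> 1 \<le> q \<Longrightarrow> 2 * q \<le> R ^ (k * d) \<Longrightarrow>
        (\<exists>i. r k / (4 * real d) \<le> \<bar>x $ i - of_int (p i) / real q\<bar>)"
    proof -
      obtain y :: "real^'n" where "\<forall>x. (\<forall>i. \<bar>x $ i - y $ i\<bar> \<le> r (Suc Q)) \<longrightarrow>
        (\<forall>k<Suc Q. \<forall>q p. 1 \<le> q \<longrightarrow> 2 * q \<le> R ^ (k * d) \<longrightarrow>
          (\<exists>i. r k / (4 * real d) \<le> \<bar>x $ i - of_int (p i) / real q\<bar>))"
        using nested_cubes_avoid_rationals[where 'n = 'n, of "Suc Q"]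
        unfolding d_def[symmetric] R_def[symmetric] r_def[symmetric] by blast
      moreover have "r (Suc Q) \<ge> 0" by (simp add: r_def)
      ultimately show thesis using that[of y] by simp
    qed
    have "\<exists>i. c * real q powr (- (1 + 1 / real d)) \<le> \<bar>x $ i - p $ i / real q\<bar>"
      if q: "1 \<le> q" "q \<le> Q" for p :: "int^'n" and q
    proof -
      obtain k where k: "k \<le> q" "2 * q \<le> R ^ (k * d)"
        "c * real q powr (- (1 + 1 / real d)) \<le> r k / (4 * real d)"
        using scale[OF q(1)] by blast
      then obtain i where "r k / (4 * real d) \<le> \<bar>x $ i - of_int (p $ i) / real q\<bar>"
        using x[of k q "\<lambda>i. p $ i"] q by auto
      with k(3) show ?thesis by (intro exI[of _ i]) linarith
    qed
    then show ?thesis by blast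
  qed
  with c show ?thesis unfolding d_def by blast
qed

subsection \<open>Bounds at the critical exponent\<close>

text \<open>A nonzero fraction with denominator \<open>q\<close> has absolute value at least
  \<open>1 / q\<close>, twice the bound \<open>1 / (2 * q)\<close> on the point. So only numerator 0
  can come closer than that.\<close>

lemma half_inverse_far_from_rationals:
  fixes p :: int and Q :: real
  assumes "1 \<le> q" "real q \<le> Q"
  shows "1 / (2 * Q) \<le> \<bar>1 / (2 * Q) - p / real q\<bar>"
    and "p \<noteq> 0 \<Longrightarrow> 1 / (2 * real q) \<le> \<bar>1 / (2 * Q) - p / real q\<bar>"
proof -
  have Qq: "0 < 1 / (2 * Q)" "1 / (2 * Q) \<le> 1 / (2 * real q)" "1 / real q = 1 / (2 * real q) + 1 / (2 * real q)"
    using assms by (auto simp: field_simps)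
  consider "p = 0" | "p \<ge> 1" | "p \<le> -1" by linarith
  then have "1 / (2 * Q) \<le> \<bar>1 / (2 * Q) - p / real q\<bar> \<and>
    (p \<noteq> 0 \<longrightarrow> 1 / (2 * real q) \<le> \<bar>1 / (2 * Q) - p / real q\<bar>)"
  proof cases
    case 1
    then show ?thesis using Qq by simp
  next
    case 2
    then have "1 / real q \<le> p / real q" using assms by (intro divide_right_mono) auto
    then show ?thesis using Qq by linarith
  next
    case 3
    then have "real_of_int p \<le> - 1" by linarith
    then have "p / real q \<le> (-1) / real q" by (intro divide_right_mono) auto
    also have "(-1) / real q = - (1 / real q)" by simp
    finally show ?thesis using Qq by linarith
  qed
  then show "1 / (2 * Q) \<le> \<bar>1 / (2 * Q) - p / real q\<bar>"
    and "p \<noteq> 0 \<Longrightarrow> 1 / (2 * real q) \<le> \<bar>1 / (2 * Q) - p / real q\<bar>" by auto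
qed

text \<open>
  In a new coordinate \<open>j\<close> the value \<open>1 / (2 Q)\<close> is badly approximated unless \<open>p j = 0\<close> and
  \<open>q \<le> Q' = Q powr ((1 - A) / a)\<close>; the remaining coordinates are chosen by induction for \<open>Q'\<close>.
\<close>
lemma critical_lower_bound_0_1:
  fixes a Q :: real
  assumes a: "0 < a" "a \<le> 1" and "card S = Suc m" "Q > 0"
  shows "\<exists>x :: 'n \<Rightarrow> real. \<forall>p :: 'n \<Rightarrow> int. \<forall>q. 1 \<le> q \<longrightarrow> real q \<le> Q \<longrightarrow>
    (\<exists>i\<in>S. 1/2 * (real q powr (-a) * Q powr (- (1 / (\<Sum>i<Suc m. a ^ i)))) \<le> \<bar>x i - p i / real q\<bar>)"
  using assms(3,4)
proof (induction m arbitrary: S Q)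
  case 0
  then obtain j where S: "S = {j}" by (metis One_nat_def card_1_singletonE)
  show ?case
  proof (intro exI[of _ "\<lambda>_. 1 / (2 * Q)"] allI impI)
    fix p :: "'n \<Rightarrow> int" and q :: nat assume q: "1 \<le> q" "real q \<le> Q"
    have "real q powr (-a) \<le> real q powr 0" using q a by (intro powr_mono) auto
    then have "1/2 * (real q powr (-a) * Q powr (-1)) \<le> 1/2 * (1 * Q powr (-1))"
      using q by (intro mult_left_mono mult_right_mono) auto
    then have "1/2 * (real q powr (-a) * Q powr (-1)) \<le> 1 / (2 * Q)"
      using 0 by (simp add: powr_minus_divide)
    then show "\<exists>i\<in>S. 1/2 * (real q powr (-a) * Q powr (- (1 / (\<Sum>i<Suc 0. a ^ i)))) \<le> \<bar>1 / (2 * Q) - p i / real q\<bar>"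
      using half_inverse_far_from_rationals(1)[OF q, of "p j"] S by simp
  qed
next
  case (Suc m)
  then obtain j S' where S: "S = insert j S'" "j \<notin> S'" "card S' = Suc m"
    by (metis card_Suc_eq)
  define s where "s = (\<Sum>i<Suc m. a ^ i)"
  define s' where "s' = (\<Sum>i<Suc (Suc m). a ^ i)"
  have s: "s > 0" unfolding s_def using a by (intro sum_pos) (auto simp: lessThan_empty_iff)
  have s': "s' = 1 + a * s"
    unfolding s'_def s_def sum.lessThan_Suc_shift[of _ "Suc m"] by (simp add: sum_distrib_left distrib_left)
  have s'_pos: "s' > 0" using s s' a by (simp add: add_pos_nonneg)
  define A where "A = 1 / s'"
  \<comment> \<open>This makes the target radius at most \<open>1 / (2 * q)\<close>, so a nonzero
    numerator in coordinate \<open>j\<close> is harmless.\<close>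
  have A_ge: "1 - a \<le> A"
  proof -
    have "(1 - a) * s' = 1 - a ^ Suc (Suc m)"
      unfolding s'_def by (rule one_diff_power_eq[symmetric])
    also have "\<dots> \<le> 1" using a by simp
    finally show ?thesis using s'_pos by (simp add: A_def field_simps)
  qed
  \<comment> \<open>Since \<open>s' = 1 + a * s\<close>, the exponent of the smaller problem at
    \<open>Q'\<close> reproduces \<open>Q powr (-A)\<close>. \<open>Q'\<close> need not be an
    integer, hence the real \<open>Q\<close> in the statement.\<close>
  define Q' where "Q' = Q powr ((1 - A) / a)"
  have "Q' > 0" using Suc.prems by (simp add: Q'_def)
  then obtain x where x: "\<And>p q. 1 \<le> q \<Longrightarrow> real q \<le> Q' \<Longrightarrow>
      (\<exists>i\<in>S'. 1/2 * (real q powr (-a) * Q' powr (- (1 / s))) \<le> \<bar>x i - of_int (p i) / real q\<bar>)"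
    using Suc.IH[OF S(3)] unfolding s_def by blast
  have Q'_powr: "Q' powr (- (1 / s)) = Q powr (-A)"
  proof -
    have "(1 - A) / a * (- (1 / s)) = - A"
      using a s s'_pos unfolding A_def by (simp add: field_simps) (simp add: s' algebra_simps)
    then show ?thesis by (simp add: Q'_def powr_powr)
  qed
  show ?case
  proof (intro exI[of _ "x(j := 1 / (2 * Q))"] allI impI)
    fix p :: "'n \<Rightarrow> int" and q :: nat assume q: "1 \<le> q" "real q \<le> Q"
    let ?b = "1/2 * (real q powr (-a) * Q powr (-A))"
    have "\<exists>i\<in>S. ?b \<le> \<bar>(x(j := 1 / (2 * Q))) i - p i / real q\<bar>"
    proof (cases "p j = 0")
      case False
      have "real q powr (1 - a) \<le> Q powr (1 - a)" using q a by (intro powr_mono2) auto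
      also have "\<dots> \<le> Q powr A" using q A_ge by (intro powr_mono) auto
      finally have "real q powr (1 - a) * (real q powr (-1) * Q powr (-A)) \<le> Q powr A * (real q powr (-1) * Q powr (-A))"
        by (intro mult_right_mono) auto
      also have "real q powr (1 - a) * (real q powr (-1) * Q powr (-A)) = real q powr (-a) * Q powr (-A)"
        unfolding mult.assoc[symmetric] powr_add[symmetric] by simp
      also have "Q powr A * (real q powr (-1) * Q powr (-A)) = 1 / real q"
        using q by (simp add: powr_minus field_simps)
      finally have "?b \<le> 1 / (2 * real q)" by simp
      then show ?thesis
        using half_inverse_far_from_rationals(2)[OF q False] S(1) by (intro bexI[of _ j]) auto
    next
      case True
      show ?thesis
      proof (cases "?b \<le> 1 / (2 * Q)")
        case True
        then show ?thesis using \<open>p j = 0\<close> q S(1) by (intro bexI[of _ j]) auto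
      next
        \<comment> \<open>Coordinate \<open>j\<close> fails only if
          \<open>real q powr a < Q powr (1 - A)\<close>, that is, only for denominators covered by
          the induction hypothesis.\<close>
        case False
        then have "Q powr (-1) < real q powr (-a) * Q powr (-A)"
          using q by (simp add: powr_minus_divide)
        then have "Q powr (-1) * (real q powr a * Q) < real q powr (-a) * Q powr (-A) * (real q powr a * Q)"
          using q by (intro mult_strict_right_mono) auto
        also have "Q powr (-1) * (real q powr a * Q) = real q powr a" using q by (simp add: powr_minus)
        also have "real q powr (-a) * Q powr (-A) * (real q powr a * Q) = Q powr (1 - A)"
          using q by (simp add: powr_minus powr_diff field_simps)
        finally have "(real q powr a) powr (1 / a) \<le> (Q powr (1 - A)) powr (1 / a)"
          using a by (intro powr_mono2) auto
        then have "real q \<le> Q'" using a q by (simp add: powr_powr Q'_def)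
        then obtain i where i: "i \<in> S'" "?b \<le> \<bar>x i - of_int (p i) / real q\<bar>"
          using x[OF q(1), of p] unfolding Q'_powr by blast
        then show ?thesis using S by (intro bexI[of _ i]) auto
      qed
    qed
    then show "\<exists>i\<in>S. 1/2 * (real q powr (-a) * Q powr (- (1 / (\<Sum>i<Suc (Suc m). a ^ i))))
        \<le> \<bar>(x(j := 1 / (2 * Q))) i - p i / real q\<bar>"
      by (simp only: A_def s'_def)
  qed
qed

lemma f_d_0_1: "0 < a \<Longrightarrow> a \<le> 1 \<Longrightarrow> f_d d a = 1 / (\<Sum>i<d. a ^ i)"
  by (simp add: f_d_def)

lemma f_d_ge_1_bounds:
  assumes "1 < a"
  shows "0 \<le> f_d d a" "1 + 1 / real d \<le> a + f_d d a"
  using assms by (auto simp: f_d_def)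

text \<open>For \<open>a \<le> 0\<close> the radius is largest at \<open>q = Q\<close>, where it is
  \<open>1 / Q\<close>, so the point with all coordinates \<open>1 / (2 * Q)\<close> works. For
  \<open>a > 1\<close> replace \<open>Q\<close> by \<open>q\<close>: the total exponent is at least
  1 + 1/d, as for badly approximable points.\<close>

lemma critical_lower_bound:
  fixes a :: real
  shows "\<exists>c>0. \<forall>Q\<ge>1. \<exists>x::real^'n. \<forall>p::int^'n. \<forall>q. 1 \<le> q \<longrightarrow> q \<le> Q \<longrightarrow>
    (\<exists>i. c * Psi a (f_d CARD('n::finite) a) q Q \<le> \<bar>x $ i - p $ i / real q\<bar>)"
proof -
  consider "a \<le> 0" | "0 < a" "a \<le> 1" | "1 < a" by linarith
  then show ?thesis
  proof cases
    case 1
    show ?thesis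
    proof (intro exI[of _ "1/2"] conjI allI impI exI)
      fix Q :: nat and p :: "int^'n" and q :: nat
      assume q: "1 \<le> Q" "1 \<le> q" "q \<le> Q"
      have "real q powr (-a) * real Q powr (- (1 - a)) \<le> real Q powr (-a) * real Q powr (- (1 - a))"
        using q 1 by (intro mult_right_mono powr_mono2) auto
      also have "\<dots> = 1 / real Q"
        unfolding powr_add[symmetric] using q by (simp add: powr_minus_divide)
      finally have "1/2 * Psi a (f_d CARD('n) a) q Q \<le> 1 / (2 * real Q)"
        using 1 by (simp add: Psi_def f_d_def)
      \<comment> \<open>All coordinates of the point agree; \<open>undefined\<close> just names one
        of them.\<close>
      then show "1/2 * Psi a (f_d CARD('n) a) q Q \<le> \<bar>(\<chi> i::'n. 1 / (2 * real Q)) $ undefined - p $ undefined / real q\<bar>"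
        using half_inverse_far_from_rationals(1)[of q "real Q" "p $ undefined"] q by simp
    qed simp
  next
    case 2
    show ?thesis
    proof (intro exI[of _ "1/2"] conjI allI impI)
      fix Q :: nat assume Q: "1 \<le> Q"
      obtain m where m: "CARD('n) = Suc m" using zero_less_card_finite[where 'a = 'n] gr0_conv_Suc by blast
      obtain x :: "'n \<Rightarrow> real" where x: "\<And>p q. 1 \<le> q \<Longrightarrow> real q \<le> real Q \<Longrightarrow>
        (\<exists>i. 1/2 * (real q powr (-a) * Q powr (- (1 / (\<Sum>i<Suc m. a ^ i)))) \<le> \<bar>x i - of_int (p i) / real q\<bar>)"
        using critical_lower_bound_0_1[OF 2 m, of "real Q"] Q by auto
      show "\<exists>x::real^'n. \<forall>p::int^'n. \<forall>q. 1 \<le> q \<longrightarrow> q \<le> Q \<longrightarrow>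
          (\<exists>i. 1/2 * Psi a (f_d CARD('n) a) q Q \<le> \<bar>x $ i - p $ i / real q\<bar>)"
      proof (intro exI[of _ "\<chi> i. x i"] allI impI)
        fix p :: "int^'n" and q assume "1 \<le> q" "q \<le> Q"
        then show "\<exists>i. 1/2 * Psi a (f_d CARD('n) a) q Q \<le> \<bar>(\<chi> i. x i) $ i - p $ i / real q\<bar>"
          using x[of q "\<lambda>i. p $ i"] by (simp only: f_d_0_1[OF 2] m Psi_def of_nat_le_iff vec_lambda_beta simp_thms)
      qed
    qed simp
  next
    case 3
    obtain c where c: "c > 0" "\<And>Q. \<exists>x::real^'n. \<forall>p::int^'n. \<forall>q. 1 \<le> q \<longrightarrow> q \<le> Q \<longrightarrow>
     (\<exists>i. c * real q powr (- (1 + 1 / real CARD('n))) \<le> \<bar>x $ i - p $ i / real q\<bar>)"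
      using badly_approximable by blast
    have Psi_le: "c * Psi a (f_d CARD('n) a) q Q \<le> c * real q powr (- (1 + 1 / real CARD('n)))"
      if q: "1 \<le> q" "q \<le> Q" for q Q
    proof -
      have "Psi a (f_d CARD('n) a) q Q \<le> real q powr (-a) * real q powr (- f_d CARD('n) a)"
        unfolding Psi_def using q f_d_ge_1_bounds[OF 3, of "CARD('n)"] by (intro mult_left_mono powr_mono2') auto
      also have "\<dots> = real q powr (- (a + f_d CARD('n) a))" by (simp add: powr_add[symmetric])
      also have "\<dots> \<le> real q powr (- (1 + 1 / real CARD('n)))"
        using q f_d_ge_1_bounds[OF 3, of "CARD('n)"] by (intro powr_mono) auto
      finally show ?thesis using c(1) by simp
    qed
    show ?thesis
    proof (intro exI[of _ c] conjI allI impI)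
      fix Q :: nat
      obtain x :: "real^'n" where x: "\<And>p::int^'n. \<And>q. 1 \<le> q \<Longrightarrow> q \<le> Q \<Longrightarrow>
        (\<exists>i. c * real q powr (- (1 + 1 / real CARD('n))) \<le> \<bar>x $ i - p $ i / real q\<bar>)"
        using c(2) by blast
      show "\<exists>x::real^'n. \<forall>p::int^'n. \<forall>q. 1 \<le> q \<longrightarrow> q \<le> Q \<longrightarrow>
          (\<exists>i. c * Psi a (f_d CARD('n) a) q Q \<le> \<bar>x $ i - p $ i / real q\<bar>)"
        using x Psi_le by (meson order_trans)
    qed (rule c)
  qed
qed

lemma critical_upper_bound:
  fixes a :: real
  shows "\<exists>C>0. \<exists>Q0. \<forall>Q\<ge>Q0. \<forall>x::real^'n. \<exists>p::int^'n. \<exists>q. 1 \<le> q \<and> q \<le> Q \<and>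
    (\<forall>i. \<bar>x $ i - p $ i / real q\<bar> \<le> C * Psi a (f_d CARD('n::finite) a) q Q)"
proof -
  consider "a \<le> 0" | "0 < a" "a \<le> 1" | "1 < a" "a \<le> 1 + 1 / real CARD('n)" | "1 < a" "1 + 1 / real CARD('n) < a"
    by linarith
  then show ?thesis
  proof cases
    case 1
    show ?thesis
    proof (rule exI[of _ 1], rule conjI, simp, rule exI[of _ "1::nat"], intro allI impI)
      fix Q :: nat and x :: "real^'n"
      assume Q: "1 \<le> Q"
      have "\<bar>x $ i - (\<chi> i. round (real Q * x $ i)) $ i / real Q\<bar> \<le> 1 * Psi a (f_d CARD('n) a) Q Q" for i
      proof -
        have "\<bar>real Q * x $ i - of_int (round (real Q * x $ i))\<bar> / real Q \<le> 1 / real Q"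
          using of_int_round_abs_le[of "real Q * x $ i"] by (intro divide_right_mono) (auto simp: abs_minus_commute)
        moreover have "\<bar>real Q * x $ i - of_int (round (real Q * x $ i))\<bar> / real Q
            = \<bar>x $ i - of_int (round (real Q * x $ i)) / real Q\<bar>"
          using Q by (simp add: abs_div_pos diff_divide_distrib)
        moreover have "Psi a (f_d CARD('n) a) Q Q = 1 / real Q"
          using 1 Q unfolding Psi_def powr_add[symmetric] by (simp add: f_d_def powr_minus_divide)
        ultimately show ?thesis by simp
      qed
      with Q show "\<exists>p::int^'n. \<exists>q. 1 \<le> q \<and> q \<le> Q \<and>
          (\<forall>i. \<bar>x $ i - p $ i / real q\<bar> \<le> 1 * Psi a (f_d CARD('n) a) q Q)" by blast
    qed
  next
    case 2
    then show ?thesis using critical_upper_bound_0_1[where 'n = 'n, OF 2] by (simp only: f_d_0_1)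
  next
    case 3
    have sum: "(\<Sum>i<CARD('n). 1 ^ i) = real CARD('n)" by simp
    obtain C Q0 where C: "C > 0" and Q0: "\<And>Q x. Q \<ge> Q0 \<Longrightarrow> \<exists>p::int^'n. \<exists>q. 1 \<le> q \<and> q \<le> Q \<and>
        (\<forall>i. \<bar>x $ i - p $ i / real q\<bar> \<le> C * Psi 1 (1 / real CARD('n)) q Q)"
      using critical_upper_bound_0_1[where 'n = 'n, OF zero_less_one order_refl, unfolded sum] by blast
    \<comment> \<open>The factor (Q/q)^(a-1) is at least 1 and turns the radius for exponent 1 into
      the one for \<open>a\<close>.\<close>
    have Psi_le: "C * Psi 1 (1 / real CARD('n)) q Q \<le> C * Psi a (f_d CARD('n) a) q Q"
      if q: "1 \<le> q" "q \<le> Q" for q Q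
    proof -
      let ?f = "1 + 1 / real CARD('n) - a"
      have "real q powr (a - 1) * (real q powr (-a) * real Q powr (- (1 / real CARD('n))))
          \<le> real Q powr (a - 1) * (real q powr (-a) * real Q powr (- (1 / real CARD('n))))"
        using q 3 by (intro mult_right_mono powr_mono2) auto
      also have "real q powr (a - 1) * (real q powr (-a) * real Q powr (- (1 / real CARD('n)))) = Psi 1 (1 / real CARD('n)) q Q"
        unfolding Psi_def mult.assoc[symmetric] powr_add[symmetric] by simp
      also have "real Q powr (a - 1) * (real q powr (-a) * real Q powr (- (1 / real CARD('n)))) = Psi a ?f q Q"
        unfolding Psi_def mult.left_commute[of "real Q powr (a - 1)"] powr_add[symmetric] by (simp add: algebra_simps)
      also have "?f = f_d CARD('n) a" using 3 by (simp add: f_d_def)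
      finally show ?thesis using C by simp
    qed
    show ?thesis
    proof (intro exI[of _ C] conjI exI[of _ Q0] allI impI)
      fix Q and x :: "real^'n" assume "Q0 \<le> Q"
      from Q0[OF this, of x] show "\<exists>p::int^'n. \<exists>q. 1 \<le> q \<and> q \<le> Q \<and>
          (\<forall>i. \<bar>x $ i - p $ i / real q\<bar> \<le> C * Psi a (f_d CARD('n) a) q Q)"
        using Psi_le by (meson order_trans)
    qed (rule C)
  next
    case 4
    show ?thesis
    proof (rule exI[of _ 1], rule conjI, simp, rule exI[of _ "1::nat"], intro allI impI)
      fix Q :: nat and x :: "real^'n"
      assume Q: "1 \<le> Q"
      have "\<bar>x $ i - (\<chi> i. round (x $ i)) $ i / real 1\<bar> \<le> 1 * Psi a (f_d CARD('n) a) 1 Q" for i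
        using of_int_round_abs_le[of "x $ i"] 4 Q by (simp add: Psi_def f_d_def abs_minus_commute)
      with Q show "\<exists>p::int^'n. \<exists>q. 1 \<le> q \<and> q \<le> Q \<and>
          (\<forall>i. \<bar>x $ i - p $ i / real q\<bar> \<le> 1 * Psi a (f_d CARD('n) a) q Q)" by blast
    qed
  qed
qed

section \<open>From the critical bounds to the three cases\<close>

lemma maxnorm_less_iff: "maxnorm (x :: real^'n) < r \<longleftrightarrow> (\<forall>i. \<bar>x $ i\<bar> < r)"
  unfolding maxnorm_def by (subst Max_less_iff) auto

lemma uniformly_approximable_UNIV_iff:
  "uniformly_approximable (UNIV :: (real^'n) set) F \<longleftrightarrow>
    (\<exists>Q0. \<forall>Q\<ge>Q0. \<forall>x::real^'n. \<exists>p::int^'n. \<exists>q. 1 \<le> q \<and> q \<le> Q \<and>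
      (\<forall>i. \<bar>x $ i - p $ i / real q\<bar> < F q Q))"
  unfolding uniformly_approximable_def approximable_def maxnorm_less_iff by simp blast

lemma powr_eventually_greater:
  fixes s :: real
  assumes "s > 0"
  obtains Q0 :: nat where "Q0 \<ge> 1" "\<And>Q. Q \<ge> Q0 \<Longrightarrow> c < real Q powr s"
proof (rule that)
  show "max 1 (nat \<lceil>(\<bar>c\<bar> + 1) powr (1 / s)\<rceil>) \<ge> 1" by simp
  fix Q assume "Q \<ge> max 1 (nat \<lceil>(\<bar>c\<bar> + 1) powr (1 / s)\<rceil>)"
  then have "(\<bar>c\<bar> + 1) powr (1 / s) \<le> real Q" by linarith
  then have "((\<bar>c\<bar> + 1) powr (1 / s)) powr s \<le> real Q powr s"
    using assms by (intro powr_mono2) auto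
  then show "c < real Q powr s" using assms by (simp add: powr_powr)
qed

lemma Psi_shift: "Psi a A q Q = Psi a f q Q * real Q powr (f - A)"
  by (simp add: Psi_def mult.assoc powr_add[symmetric])

theorem theorem1:
  fixes a A :: real
  defines "d \<equiv> CARD('n::finite)"
  shows "(A < f_d d a \<longrightarrow>
            (\<forall>\<epsilon>>0. uniformly_approximable (UNIV :: (real^'n) set) (\<lambda>q Q. \<epsilon> * Psi a A q Q)))
       \<and> (A > f_d d a \<longrightarrow>
            (\<forall>\<kappa>>0. \<not> uniformly_approximable (UNIV :: (real^'n) set) (\<lambda>q Q. \<kappa> * Psi a A q Q)))
       \<and> (A = f_d d a \<longrightarrow>
            (\<exists>\<epsilon> \<kappa>. 0 < \<epsilon> \<and> \<epsilon> \<le> \<kappa> \<and>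
               uniformly_approximable (UNIV :: (real^'n) set) (\<lambda>q Q. \<kappa> * Psi a A q Q) \<and>
               \<not> uniformly_approximable (UNIV :: (real^'n) set) (\<lambda>q Q. \<epsilon> * Psi a A q Q)))"
proof -
  define f where "f = f_d d a"
  obtain C Q0 where C: "C > 0" and upper: "\<And>Q x. Q \<ge> Q0 \<Longrightarrow> \<exists>p::int^'n. \<exists>q. 1 \<le> q \<and> q \<le> Q \<and>
      (\<forall>i. \<bar>x $ i - p $ i / real q\<bar> \<le> C * Psi a f q Q)"
    using critical_upper_bound[where 'n = 'n, of a] unfolding f_def d_def by blast
  obtain c where c: "c > 0" and lower: "\<And>Q. Q \<ge> 1 \<Longrightarrow> \<exists>x::real^'n. \<forall>p::int^'n. \<forall>q. 1 \<le> q \<longrightarrow> q \<le> Q \<longrightarrow>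
      (\<exists>i. c * Psi a f q Q \<le> \<bar>x $ i - p $ i / real q\<bar>)"
    using critical_lower_bound[where 'n = 'n, of a] unfolding f_def d_def by blast
  have Psi_pos: "Psi a B q Q > 0" if "1 \<le> q" "q \<le> Q" for B q Q using that by (simp add: Psi_def)
  \<comment> \<open>The covering bound is not strict, so a strictly larger radius is required
    here.\<close>
  have approx: "uniformly_approximable (UNIV :: (real^'n) set) F"
    if "\<And>q Q. Q1 \<le> Q \<Longrightarrow> 1 \<le> q \<Longrightarrow> q \<le> Q \<Longrightarrow> C * Psi a f q Q < F q Q" for F Q1
    unfolding uniformly_approximable_UNIV_iff
  proof (intro exI[of _ "max Q0 Q1"] allI impI)
    fix Q and x :: "real^'n" assume "max Q0 Q1 \<le> Q"
    then show "\<exists>p::int^'n. \<exists>q. 1 \<le> q \<and> q \<le> Q \<and> (\<forall>i. \<bar>x $ i - p $ i / real q\<bar> < F q Q)"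
      using upper[of Q x] that[of Q] by (meson le_less_trans max.bounded_iff)
  qed
  \<comment> \<open>A common threshold is refuted by one bad point at a single large
    \<open>Q\<close>; that point may depend on \<open>Q\<close>.\<close>
  have not_approx: "\<not> uniformly_approximable (UNIV :: (real^'n) set) F"
    if F: "\<And>q Q. Q1 \<le> Q \<Longrightarrow> 1 \<le> q \<Longrightarrow> q \<le> Q \<Longrightarrow> F q Q \<le> c * Psi a f q Q" for F Q1
    unfolding uniformly_approximable_UNIV_iff
  proof
    assume "\<exists>Q0. \<forall>Q\<ge>Q0. \<forall>x::real^'n. \<exists>p::int^'n. \<exists>q. 1 \<le> q \<and> q \<le> Q \<and> (\<forall>i. \<bar>x $ i - p $ i / real q\<bar> < F q Q)"
    then obtain Q2 where Q2: "\<And>Q x. Q \<ge> Q2 \<Longrightarrow>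
      \<exists>p::int^'n. \<exists>q. 1 \<le> q \<and> q \<le> Q \<and> (\<forall>i. \<bar>x $ i - p $ i / real q\<bar> < F q Q)" by blast
    define Q where "Q = max 1 (max Q1 Q2)"
    obtain x :: "real^'n" where x: "\<And>p::int^'n. \<And>q. 1 \<le> q \<Longrightarrow> q \<le> Q \<Longrightarrow>
        \<exists>i. c * Psi a f q Q \<le> \<bar>x $ i - p $ i / real q\<bar>"
      using lower[of Q] by (auto simp: Q_def)
    obtain p :: "int^'n" and q where pq: "1 \<le> q" "q \<le> Q" "\<And>i. \<bar>x $ i - p $ i / real q\<bar> < F q Q"
      using Q2[of Q x] unfolding Q_def by (metis max.cobounded2 max.coboundedI2)
    obtain i where "c * Psi a f q Q \<le> \<bar>x $ i - p $ i / real q\<bar>" using x pq by blast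
    moreover have "Q1 \<le> Q" by (simp add: Q_def)
    ultimately show False using pq(3)[of i] F[OF _ pq(1,2)] by fastforce
  qed
  have "uniformly_approximable (UNIV :: (real^'n) set) (\<lambda>q Q. \<epsilon> * Psi a A q Q)" if "A < f" "\<epsilon> > 0" for \<epsilon>
  proof -
    obtain Q1 where Q1: "Q1 \<ge> 1" "\<And>Q. Q \<ge> Q1 \<Longrightarrow> C / \<epsilon> < real Q powr (f - A)"
      using powr_eventually_greater[of "f - A"] \<open>A < f\<close> by auto
    show ?thesis
    proof (rule approx[of Q1])
      fix q Q assume q: "Q1 \<le> Q" "1 \<le> q" "q \<le> Q"
      have "C < \<epsilon> * real Q powr (f - A)" using Q1(2)[OF q(1)] \<open>\<epsilon> > 0\<close> by (simp add: field_simps)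
      then have "C * Psi a f q Q < \<epsilon> * real Q powr (f - A) * Psi a f q Q"
        using Psi_pos[OF q(2,3)] by (intro mult_strict_right_mono)
      then show "C * Psi a f q Q < \<epsilon> * Psi a A q Q" by (subst Psi_shift[of a A q Q f]) (simp add: mult_ac)
    qed
  qed
  moreover have "\<not> uniformly_approximable (UNIV :: (real^'n) set) (\<lambda>q Q. \<kappa> * Psi a A q Q)" if "A > f" "\<kappa> > 0" for \<kappa>
  proof -
    obtain Q1 where Q1: "Q1 \<ge> 1" "\<And>Q. Q \<ge> Q1 \<Longrightarrow> \<kappa> / c < real Q powr (A - f)"
      using powr_eventually_greater[of "A - f"] \<open>A > f\<close> by auto
    show ?thesis
    proof (rule not_approx[of Q1])
      fix q Q assume q: "Q1 \<le> Q" "1 \<le> q" "q \<le> Q"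
      have "\<kappa> < c * real Q powr (A - f)" using Q1(2)[OF q(1)] c by (simp add: field_simps)
      then have "\<kappa> * Psi a A q Q \<le> c * real Q powr (A - f) * Psi a A q Q"
        using Psi_pos[OF q(2,3), of A] by (intro mult_right_mono) auto
      then show "\<kappa> * Psi a A q Q \<le> c * Psi a f q Q" by (subst Psi_shift[of a f q Q A]) (simp add: mult_ac)
    qed
  qed
  \<comment> \<open>\<open>2 * C\<close> provides the strict inequality for covering, and
    \<open>min c C\<close> guarantees \<open>\<epsilon> \<le> \<kappa>\<close> while staying below
    \<open>c\<close>.\<close>
  moreover have "\<exists>\<epsilon> \<kappa>. 0 < \<epsilon> \<and> \<epsilon> \<le> \<kappa> \<and>
      uniformly_approximable (UNIV :: (real^'n) set) (\<lambda>q Q. \<kappa> * Psi a A q Q) \<and>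
      \<not> uniformly_approximable (UNIV :: (real^'n) set) (\<lambda>q Q. \<epsilon> * Psi a A q Q)" if "A = f"
  proof (rule exI[of _ "min c C"], rule exI[of _ "2 * C"], intro conjI)
    show "uniformly_approximable (UNIV :: (real^'n) set) (\<lambda>q Q. 2 * C * Psi a A q Q)"
      using C Psi_pos that by (intro approx[of 0]) auto
    show "\<not> uniformly_approximable (UNIV :: (real^'n) set) (\<lambda>q Q. min c C * Psi a A q Q)"
      using Psi_pos that by (intro not_approx[of 0]) (auto intro!: mult_right_mono less_imp_le)
  qed (use C c in auto)
  ultimately show ?thesis unfolding f_def by blast
qed

end
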